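(* Let $G$ be an infinite Abelian group and let $\kappa$ be a cardinal. Then $G$ contains a subset $A\subset G$ with sharp packing index $\mathrm{ind}_P^\sharp(A)=\kappa$ if and only if one of the following conditions holds: (1) $2\le\kappa\le|G|^+$ and $\kappa\notin\{3,4\}$; (2) $\kappa=3$ and $G$ is not isomorphic to a direct sum $\bigoplus_{i\in I}\mathbb{Z}_3$ (for any index set $I$); (3) $\kappa=4$ and $G$ is isomorphic neither to $\bigoplus_{i\in I}\mathbb{Z}_2$ nor to $\mathbb{Z}_4\oplus\big(\bigoplus_{i\in I}\mathbb{Z}_2\big)$ (for any index set $I$).
   Context: For a subset $A$ of an Abelian group $G$, the sharp packing index $\mathrm{ind}_P^\sharp(A)$ is the smallest cardinal $\kappa$ such that for every subset $B\subset G$ of size $|B|\ge\kappa$ the indexed family $\{b+A: b\in B\}$ is not disjoint. Here the family $\{b+A:b\in B\}$ is called disjoint if $(b+A)\cap(b'+A)=\emptyset$ for all distinct $b,b'\in B$ (for nonempty $A$ and $B$ this is equivalent to $(B-B)\cap(A-A)=\{0\}$, where $X-X=\{x-y:x,y\in X\}$). $\mathbb{Z}_n$ is the cyclic group of order $n$; $|G|^+$ is the successor cardinal of $|G|$. *)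

theory Defs
  imports
    "HOL-Algebra.Elementary_Groups"
    "HOL-Algebra.Product_Groups"
    "HOL-Algebra.Coset"
    "HOL-Library.Disjoint_Sets"
begin

unbundle cardinal_syntax

text \<open>
  Abelian groups are HOL-Algebra's \<open>comm_group\<close>s, written multiplicatively: the translate
  \<open>b + A\<close> is the coset \<open>b <#\<^bsub>G\<^esub> A\<close>.  Cardinals are the relations \<open>\<kappa>\<close> with \<open>Card_order \<kappa>\<close> (over any
  carrier type), compared by \<open>\<le>o\<close> and identified by \<open>=o\<close>; the finite cardinal \<open>n\<close> is
  \<open>natLeq_on n\<close>.
\<close>

definition no_packing_of_size ::
    "('a, 'm) monoid_scheme \<Rightarrow> 'a set \<Rightarrow> 'k rel \<Rightarrow> bool" where
  "no_packing_of_size G A \<kappa> \<longleftrightarrow>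
     (\<forall>B \<subseteq> carrier G. \<kappa> \<le>o |B| \<longrightarrow> \<not> disjoint_family_on (\<lambda>b. b <#\<^bsub>G\<^esub> A) B)"

text \<open>
  Every \<open>B \<subseteq> carrier G\<close> has fewer than \<open>|carrier G|\<^sup>+\<close> elements, and this successor
  cardinal has a representative on \<open>'a set\<close>.  Hence the smallest cardinal
  in question exists on \<open>'a set\<close>, and the type restriction is harmless: the three lemmas
  following the definition show that the value is the smallest one among the cardinals on all types.
\<close>

definition sharp_packing_index ::
    "('a, 'm) monoid_scheme \<Rightarrow> 'a set \<Rightarrow> 'a set rel" where
  "sharp_packing_index G A =
     (SOME \<kappa>. Card_order \<kappa> \<and> no_packing_of_size G A \<kappa> \<and>
        (\<forall>\<kappa>' :: 'a set rel. Card_order \<kappa>' \<and> no_packing_of_size G A \<kappa>' \<longrightarrow> \<kappa> \<le>o \<kappa>'))"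

lemma no_packing_of_size_cardSuc: "no_packing_of_size G A (cardSuc |carrier G| )"
  unfolding no_packing_of_size_def
proof (intro allI impI)
  fix B assume B: "B \<subseteq> carrier G" and le: "cardSuc |carrier G| \<le>o |B|"
  have "|B| \<le>o |carrier G|" using B by (rule card_of_mono1)
  moreover have "|carrier G| <o cardSuc |carrier G|"
    by (rule cardSuc_greater[OF card_of_Card_order])
  ultimately have "|B| <o cardSuc |carrier G|" by (rule ordLeq_ordLess_trans)
  with le show "\<not> disjoint_family_on (\<lambda>b. b <#\<^bsub>G\<^esub> A) B"
    using not_ordLess_ordLeq by blast
qed

lemma no_packing_of_size_cong:
  assumes "\<kappa> =o \<kappa>'" "no_packing_of_size G A \<kappa>"
  shows "no_packing_of_size G A \<kappa>'"
  using assms unfolding no_packing_of_size_def by (meson ordIso_ordLeq_trans)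

lemma sharp_packing_index_props:
  fixes G :: "('a, 'm) monoid_scheme"
  shows "Card_order (sharp_packing_index G A) \<and> no_packing_of_size G A (sharp_packing_index G A) \<and>
    (\<forall>\<kappa>' :: 'a set rel. Card_order \<kappa>' \<and> no_packing_of_size G A \<kappa>' \<longrightarrow>
       sharp_packing_index G A \<le>o \<kappa>')"
proof -
  let ?R = "{\<kappa> :: 'a set rel. Card_order \<kappa> \<and> no_packing_of_size G A \<kappa>}"
  have "cardSuc |carrier G| \<in> ?R"
    using no_packing_of_size_cardSuc cardSuc_Card_order[OF card_of_Card_order] by blast
  hence "\<exists>r\<in>?R. \<forall>r'\<in>?R. r \<le>o r'"
    by (intro exists_minim_Card_order) auto
  then obtain \<kappa> where "\<kappa> \<in> ?R" "\<forall>r'\<in>?R. \<kappa> \<le>o r'" by (rule bexE)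
  hence "Card_order \<kappa> \<and> no_packing_of_size G A \<kappa> \<and>
      (\<forall>\<kappa>' :: 'a set rel. Card_order \<kappa>' \<and> no_packing_of_size G A \<kappa>' \<longrightarrow> \<kappa> \<le>o \<kappa>')"
    by simp
  thus ?thesis unfolding sharp_packing_index_def by (rule someI)
qed

lemma Card_order_sharp_packing_index: "Card_order (sharp_packing_index G A)"
  and no_packing_of_size_sharp_packing_index:
    "no_packing_of_size G A (sharp_packing_index G A)"
  using sharp_packing_index_props by blast+

lemma sharp_packing_index_least:
  fixes G :: "('a, 'm) monoid_scheme" and \<kappa> :: "'k rel"
  assumes "Card_order \<kappa>" "no_packing_of_size G A \<kappa>"
  shows "sharp_packing_index G A \<le>o \<kappa>"
proof (rule ccontr)
  let ?p = "sharp_packing_index G A"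
  assume "\<not> ?p \<le>o \<kappa>"
  hence less: "\<kappa> <o ?p"
    using assms(1) Card_order_sharp_packing_index
    by (meson card_order_on_well_order_on not_ordLeq_iff_ordLess)
  then obtain \<kappa>' :: "'a set rel" where k': "\<kappa> =o \<kappa>'" "\<kappa>' <o ?p"
    using internalize_ordLess[of \<kappa> ?p] by blast
  have "Card_order \<kappa>'" using assms(1) k'(1) Card_order_ordIso2 by blast
  moreover have "no_packing_of_size G A \<kappa>'"
    using k'(1) assms(2) by (rule no_packing_of_size_cong)
  ultimately have "?p \<le>o \<kappa>'" using sharp_packing_index_props by blast
  with k'(2) show False using not_ordLess_ordLeq by blast
qed

text \<open>
  HOL cannot quantify over the type of an index set, so ``for some index set \<open>I\<close>'' in
  \<open>G \<cong> \<Oplus>\<^sub>I \<int>\<^sub>n\<close> is stated with \<open>I\<close> a set over the carrier type of \<open>G\<close>.  For \<open>n \<ge> 2\<close> this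
  loses nothing: such an \<open>I\<close>, of any type, injects into \<open>carrier G\<close> and can be replaced by its image
  (\<open>sum_group_index_type\<close>, \<open>DirProd_sum_group_index_type\<close>).
\<close>

lemma sum_group_reindex:
  fixes f :: "'i \<Rightarrow> 'j" and H :: "('h, 'm) monoid_scheme"
  assumes f: "inj_on f I" and H: "group H"
  shows "sum_group I (\<lambda>_. H) \<cong> sum_group (f ` I) (\<lambda>_. H)"
proof -
  define g where "g = inv_into I f"
  have gf: "g (f i) = i" if "i \<in> I" for i using f that by (simp add: g_def)
  have fg: "f (g j) = j" "g j \<in> I" if "j \<in> f ` I" for j
    using that by (auto simp: gf)
  define h where "h = (\<lambda>x :: 'i \<Rightarrow> 'h. \<lambda>j\<in>f ` I. x (g j))"
  define k where "k = (\<lambda>y :: 'j \<Rightarrow> 'h. \<lambda>i\<in>I. y (f i))"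
  have hc: "h x \<in> carrier (sum_group (f ` I) (\<lambda>_. H))"
    if "x \<in> carrier (sum_group I (\<lambda>_. H))" for x
  proof -
    have x: "x \<in> I \<rightarrow>\<^sub>E carrier H" "finite {i \<in> I. x i \<noteq> \<one>\<^bsub>H\<^esub>}"
      using that H by (auto simp: carrier_sum_group)
    have "{j \<in> f ` I. h x j \<noteq> \<one>\<^bsub>H\<^esub>} \<subseteq> f ` {i \<in> I. x i \<noteq> \<one>\<^bsub>H\<^esub>}"
      by (auto simp: h_def gf)
    hence "finite {j \<in> f ` I. h x j \<noteq> \<one>\<^bsub>H\<^esub>}" by (rule finite_surj[OF x(2)])
    moreover have "h x \<in> f ` I \<rightarrow>\<^sub>E carrier H"
      using x(1) by (auto simp: h_def gf)
    ultimately show ?thesis using H by (simp add: carrier_sum_group)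
  qed
  have kc: "k y \<in> carrier (sum_group I (\<lambda>_. H))"
    if "y \<in> carrier (sum_group (f ` I) (\<lambda>_. H))" for y
  proof -
    have y: "y \<in> f ` I \<rightarrow>\<^sub>E carrier H" "finite {j \<in> f ` I. y j \<noteq> \<one>\<^bsub>H\<^esub>}"
      using that H by (auto simp: carrier_sum_group)
    have "{i \<in> I. k y i \<noteq> \<one>\<^bsub>H\<^esub>} \<subseteq> g ` {j \<in> f ` I. y j \<noteq> \<one>\<^bsub>H\<^esub>}"
    proof
      fix i assume "i \<in> {i \<in> I. k y i \<noteq> \<one>\<^bsub>H\<^esub>}"
      hence "i = g (f i)" "f i \<in> {j \<in> f ` I. y j \<noteq> \<one>\<^bsub>H\<^esub>}"
        by (auto simp: k_def gf)
      thus "i \<in> g ` {j \<in> f ` I. y j \<noteq> \<one>\<^bsub>H\<^esub>}" by (rule image_eqI)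
    qed
    hence "finite {i \<in> I. k y i \<noteq> \<one>\<^bsub>H\<^esub>}" by (rule finite_surj[OF y(2)])
    moreover have "k y \<in> I \<rightarrow>\<^sub>E carrier H"
      using y(1) by (auto simp: k_def)
    ultimately show ?thesis using H by (simp add: carrier_sum_group)
  qed
  have kh: "k (h x) = x" if "x \<in> carrier (sum_group I (\<lambda>_. H))" for x
  proof -
    have "x i = undefined" if "i \<notin> I" for i
      using that \<open>x \<in> _\<close> H by (simp add: carrier_sum_group PiE_iff extensional_def)
    thus ?thesis by (auto simp: h_def k_def gf fun_eq_iff)
  qed
  have hk: "h (k y) = y" if "y \<in> carrier (sum_group (f ` I) (\<lambda>_. H))" for y
  proof -
    have "y j = undefined" if "j \<notin> f ` I" for j
      using that \<open>y \<in> _\<close> H by (simp add: carrier_sum_group PiE_iff extensional_def)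
    thus ?thesis by (auto simp: h_def k_def gf fun_eq_iff)
  qed
  have "h \<in> hom (sum_group I (\<lambda>_. H)) (sum_group (f ` I) (\<lambda>_. H))"
  proof (rule homI)
    show "h x \<in> carrier (sum_group (f ` I) (\<lambda>_. H))"
      if "x \<in> carrier (sum_group I (\<lambda>_. H))" for x
      using that by (rule hc)
  next
    show "h (x \<otimes>\<^bsub>sum_group I (\<lambda>_. H)\<^esub> y) = h x \<otimes>\<^bsub>sum_group (f ` I) (\<lambda>_. H)\<^esub> h y" for x y
      using fg by (auto simp: h_def fun_eq_iff restrict_def)
  qed
  moreover have "bij_betw h (carrier (sum_group I (\<lambda>_. H))) (carrier (sum_group (f ` I) (\<lambda>_. H)))"
    by (rule bij_betw_byWitness[of _ k]) (simp_all add: hc kc kh hk image_subset_iff)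
  ultimately show ?thesis by (intro is_isoI[of h]) (simp add: iso_def)
qed

lemma inj_sum_group_index:
  assumes n: "n \<ge> 2"
  shows "\<exists>e. inj_on e I \<and> e ` I \<subseteq> carrier (sum_group I (\<lambda>_. integer_mod_group n))"
proof (intro exI conjI)
  let ?e = "\<lambda>i. \<lambda>j\<in>I. if j = i then 1 else (0::int)"
  show "inj_on ?e I"
  proof (rule inj_onI)
    fix i i' assume i: "i \<in> I" "i' \<in> I" and eq: "?e i = ?e i'"
    from fun_cong[OF eq, of i] i show "i = i'" by (auto split: if_splits)
  qed
  have "?e i \<in> carrier (sum_group I (\<lambda>_. integer_mod_group n))" if "i \<in> I" for i
  proof -
    have "{j \<in> I. ?e i j \<noteq> 0} \<subseteq> {i}" by (auto split: if_splits)
    hence "finite {j \<in> I. ?e i j \<noteq> 0}" by (rule finite_subset) simp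
    thus ?thesis using n by (auto simp: carrier_sum_group carrier_integer_mod_group)
  qed
  thus "?e ` I \<subseteq> carrier (sum_group I (\<lambda>_. integer_mod_group n))" by blast
qed

lemma sum_group_index_in_carrier:
  fixes G :: "('a, 'm) monoid_scheme" and I :: "'i set"
  assumes n: "n \<ge> 2"
    and u: "inj_on u (carrier (sum_group I (\<lambda>_. integer_mod_group n)))"
      "u ` carrier (sum_group I (\<lambda>_. integer_mod_group n)) \<subseteq> carrier G"
  shows "\<exists>J \<subseteq> carrier G.
    sum_group I (\<lambda>_. integer_mod_group n) \<cong> sum_group J (\<lambda>_. integer_mod_group n)"
proof -
  obtain e where e: "inj_on e I" "e ` I \<subseteq> carrier (sum_group I (\<lambda>_. integer_mod_group n))"
    using inj_sum_group_index[OF n, where I = I] by (elim exE conjE)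
  have "inj_on (u \<circ> e) I" using comp_inj_on[OF e(1) inj_on_subset[OF u(1) e(2)]] .
  hence "sum_group I (\<lambda>_. integer_mod_group n) \<cong>
      sum_group ((u \<circ> e) ` I) (\<lambda>_. integer_mod_group n)"
    by (rule sum_group_reindex) simp
  moreover have "(u \<circ> e) ` I \<subseteq> carrier G"
    unfolding image_comp[symmetric] using image_mono[OF e(2)] u(2) by (rule subset_trans)
  ultimately show ?thesis by (intro exI[of _ "(u \<circ> e) ` I"] conjI)
qed

lemma sum_group_index_type:
  fixes G :: "('a, 'm) monoid_scheme" and I :: "'i set"
  assumes "group G" "n \<ge> 2" and iso: "G \<cong> sum_group I (\<lambda>_. integer_mod_group n)"
  shows "\<exists>J :: 'a set. G \<cong> sum_group J (\<lambda>_. integer_mod_group n)"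
proof -
  have "sum_group I (\<lambda>_. integer_mod_group n) \<cong> G"
    using group.iso_sym[OF assms(1) iso] .
  then obtain u where "u \<in> iso (sum_group I (\<lambda>_. integer_mod_group n)) G"
    unfolding is_iso_def ex_in_conv[symmetric] by (rule exE)
  hence "inj_on u (carrier (sum_group I (\<lambda>_. integer_mod_group n)))"
      "u ` carrier (sum_group I (\<lambda>_. integer_mod_group n)) \<subseteq> carrier G"
    by (simp_all add: iso_iff)
  from sum_group_index_in_carrier[OF assms(2) this] obtain J :: "'a set" where
    "sum_group I (\<lambda>_. integer_mod_group n) \<cong> sum_group J (\<lambda>_. integer_mod_group n)"
    by (elim exE conjE)
  hence "G \<cong> sum_group J (\<lambda>_. integer_mod_group n)" by (rule iso_trans[OF iso])
  thus ?thesis by (rule exI)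
qed

lemma DirProd_sum_group_index_type:
  fixes G :: "('a, 'm) monoid_scheme" and I :: "'i set"
  assumes "group G" "n \<ge> 2" "group H"
    and iso: "G \<cong> H \<times>\<times> sum_group I (\<lambda>_. integer_mod_group n)"
  shows "\<exists>J :: 'a set. G \<cong> H \<times>\<times> sum_group J (\<lambda>_. integer_mod_group n)"
proof -
  let ?S = "\<lambda>I. sum_group I (\<lambda>_. integer_mod_group n)"
  have "H \<times>\<times> ?S I \<cong> G"
    using group.iso_sym[OF assms(1) iso] .
  then obtain u where "u \<in> iso (H \<times>\<times> ?S I) G"
    unfolding is_iso_def ex_in_conv[symmetric] by (rule exE)
  hence u: "inj_on u (carrier H \<times> carrier (?S I))"
      "u ` (carrier H \<times> carrier (?S I)) \<subseteq> carrier G"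
    by (simp_all add: iso_iff)
  have one: "\<one>\<^bsub>H\<^esub> \<in> carrier H" by (rule monoid.one_closed[OF group.is_monoid[OF assms(3)]])
  have inj: "inj_on (\<lambda>x. u (\<one>\<^bsub>H\<^esub>, x)) (carrier (?S I))"
    using u(1) one by (auto simp: inj_on_def)
  have "(\<lambda>x. u (\<one>\<^bsub>H\<^esub>, x)) ` carrier (?S I) \<subseteq> carrier G"
    using u(2) one by (simp add: image_subset_iff)
  from sum_group_index_in_carrier[OF assms(2) inj this]
  obtain J :: "'a set" where "?S I \<cong> ?S J"
    by (elim exE conjE)
  hence "H \<times>\<times> ?S I \<cong> H \<times>\<times> ?S J"
    by (rule group.DirProd_iso_trans[OF assms(3) iso_refl])
  hence "G \<cong> H \<times>\<times> ?S J" by (rule iso_trans[OF iso])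
  thus ?thesis by (rule exI)
qed

end

theory Submission
  imports Defs "HOL-Algebra.Free_Abelian_Groups"
    "HOL-Computational_Algebra.Primes"
begin

text \<open>
  A family \<open>{b + A: b \<in> B}\<close> is disjoint iff all differences of distinct elements of \<open>B\<close> lie in
  \<open>F = G - (A - A)\<close>, that is, iff \<open>B\<close> is a clique of the Cayley graph of \<open>F\<close>.  Conversely, a
  transfinite construction, which adjoins pairs \<open>x, x + g\<close> to \<open>A\<close> one by one, realizes every symmetric
  \<open>F\<close> without \<open>0\<close> as \<open>G - (A - A)\<close>, provided that fewer than \<open>|G|\<close> translates of \<open>F\<close> never cover
  \<open>G\<close>.  So one has to find Cayley graphs with prescribed clique sizes.

  Every infinite \<open>G\<close> contains a subset \<open>E\<close> of size \<open>|G|\<close> that satisfies only those relations between six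
  elements that hold in a free \<open>\<int>\<^sub>r\<close>-module, for some \<open>r \<in> {0, 2, 3}\<close> (where \<open>\<int>\<^sub>0 = \<int>\<close>).  For finite
  \<open>B \<subseteq> E\<close> with \<open>n\<close> elements, \<open>F = (B - B) - {0}\<close> has clique number \<open>n\<close> as soon as \<open>n \<ge> 4\<close>: the
  nonzero elements of a clique through \<open>0\<close> are pairwise intersecting edges on the vertex set \<open>B\<close>.  Disjoint
  blocks \<open>B\<^sub>g \<subseteq> E\<close> of all sizes below an infinite \<open>\<kappa>\<close> give the infinite values.

  For \<open>\<kappa> = 3\<close> one takes \<open>F = {g, -g}\<close> with \<open>3g \<noteq> 0\<close>; in exponent 3, \<open>{b, b'}\<close> always extends to the clique
  \<open>{b, b', 2b' - b}\<close>.  For \<open>\<kappa> = 4\<close> and \<open>r = 2\<close> one takes a hexagon \<open>F = {\<plusminus>u, \<plusminus>v, \<plusminus>(u + v)}\<close>, which is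
  possible iff \<open>2G\<close> has more than two elements; otherwise among three elements there are \<open>x, y\<close> with
  \<open>2x = 2y\<close>, and \<open>{x, y, z}\<close> extends by \<open>y + z - x\<close>.
\<close>

subsection \<open>Cardinals\<close>

lemma card_of_Times_ordLess_infinite:
  assumes C: "infinite C" and A: "|A| <o |C|" and B: "|B| <o |C|"
  shows "|A \<times> B| <o |C|"
proof (cases "finite (A \<times> B)")
  case True
  show ?thesis
    by (rule finite_ordLess_infinite) (use True C in \<open>auto simp: card_of_Well_order\<close>)
next
  case False
  then have ne: "A \<noteq> {}" "B \<noteq> {}" and "infinite A \<or> infinite B"
    by auto
  have "|A| \<le>o |B| \<or> |B| \<le>o |A|"
    by (rule ordLeq_total[OF card_of_Well_order card_of_Well_order])
  then show ?thesis
  proof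
    assume le: "|A| \<le>o |B|"
    then have "infinite B" using \<open>infinite A \<or> infinite B\<close> card_of_ordLeq_infinite by blast
    then have "|A \<times> B| =o |B|" using card_of_Times_infinite[of B A] ne le by blast
    then show ?thesis using B ordIso_ordLess_trans by blast
  next
    assume le: "|B| \<le>o |A|"
    then have "infinite A" using \<open>infinite A \<or> infinite B\<close> card_of_ordLeq_infinite by blast
    then have "|A \<times> B| =o |A|" using card_of_Times_infinite[of A B] ne le by blast
    then show ?thesis using A ordIso_ordLess_trans by blast
  qed
qed

lemma card_of_image_ordLess: "|A| <o r \<Longrightarrow> |f ` A| <o r"
  using card_of_image ordLeq_ordLess_trans by blast

lemma card_of_subset_ordLess: "A \<subseteq> B \<Longrightarrow> |B| <o r \<Longrightarrow> |A| <o r"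
  using card_of_mono1 ordLeq_ordLess_trans by blast

lemma finite_card_of_ordLess_infinite: "finite A \<Longrightarrow> infinite C \<Longrightarrow> |A| <o |C|"
  by (rule finite_ordLess_infinite) (auto simp: card_of_Well_order)

lemma card_of_natLeq_on_card: "finite A \<Longrightarrow> |A| =o natLeq_on (card A)"
proof -
  assume A: "finite A"
  obtain h where "bij_betw h A {0..<card A}"
    using ex_bij_betw_finite_nat[OF A] by blast
  then have "|A| =o |{0..<card A}|"
    using card_of_ordIso by blast
  moreover have "|{0..<card A}| =o natLeq_on (card A)"
  proof (rule finite_well_order_on_ordIso[of "{0..<card A}"])
    show "well_order_on {0..<card A} (natLeq_on (card A))"
      using natLeq_on_well_order_on[of "card A"] by (simp add: lessThan_def[symmetric] atLeast0LessThan)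
  qed (auto simp: card_of_well_order_on)
  ultimately show ?thesis using ordIso_transitive by blast
qed

lemma ordIso_ordLeq_iff:
  assumes "r =o r'"
  shows "r \<le>o s \<longleftrightarrow> r' \<le>o s" "s \<le>o r \<longleftrightarrow> s \<le>o r'"
proof -
  show "r \<le>o s \<longleftrightarrow> r' \<le>o s"
    by (rule iffI) (erule ordIso_ordLeq_trans[OF assms] ordIso_ordLeq_trans[OF ordIso_symmetric[OF assms]])+
  show "s \<le>o r \<longleftrightarrow> s \<le>o r'"
    by (rule iffI) (erule ordLeq_ordIso_trans[OF _ assms] ordLeq_ordIso_trans[OF _ ordIso_symmetric[OF assms]])+
qed

lemma natLeq_on_ordIso_card_of: "natLeq_on n =o |{..<n}|"
  using ordIso_symmetric[OF card_of_natLeq_on_card[of "{..<n}"]] by simp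

lemma Card_order_natLeq_on: "Card_order (natLeq_on n)"
  by (rule Card_order_ordIso[OF card_of_Card_order natLeq_on_ordIso_card_of])

lemma natLeq_on_ordLeq_card_of_iff: "natLeq_on n \<le>o |B| \<longleftrightarrow> (finite B \<longrightarrow> n \<le> card B)"
proof -
  have "natLeq_on n \<le>o |B| \<longleftrightarrow> |{..<n}| \<le>o |B|"
    by (rule ordIso_ordLeq_iff(1)[OF natLeq_on_ordIso_card_of])
  also have "\<dots> \<longleftrightarrow> (finite B \<longrightarrow> n \<le> card B)"
  proof (cases "finite B")
    case True
    then show ?thesis
      using inj_on_iff_card_le[of "{..<n}" B] by (simp add: card_of_ordLeq[symmetric])
  next
    case False
    then have "|{..<n}| <o |B|" by (simp add: finite_card_of_ordLess_infinite)
    then show ?thesis using False ordLess_imp_ordLeq by blast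
  qed
  finally show ?thesis .
qed

lemma natLeq_on_ordLeq_iff:
  assumes "Card_order \<kappa>"
  shows "natLeq_on n \<le>o \<kappa> \<longleftrightarrow> (finite (Field \<kappa>) \<longrightarrow> n \<le> card (Field \<kappa>))"
  by (simp add: ordIso_ordLeq_iff(2)[OF card_of_Field_ordIso[OF assms], symmetric]
      natLeq_on_ordLeq_card_of_iff)

lemma card_of_ordLess_natLeq_on_iff: "|B| <o natLeq_on n \<longleftrightarrow> finite B \<and> card B < n"
proof -
  have "|B| <o natLeq_on n \<longleftrightarrow> \<not> natLeq_on n \<le>o |B|"
    by (rule not_ordLeq_iff_ordLess[OF card_of_Well_order natLeq_on_Well_order, symmetric])
  then show ?thesis by (simp only: natLeq_on_ordLeq_card_of_iff not_imp not_le)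
qed

lemma finite_Card_order_ordIso_natLeq_on:
  assumes "Card_order \<kappa>" "finite (Field \<kappa>)"
  shows "\<kappa> =o natLeq_on (card (Field \<kappa>))"
  by (rule ordIso_transitive[OF ordIso_symmetric[OF card_of_Field_ordIso[OF assms(1)]]
      card_of_natLeq_on_card[OF assms(2)]])

text \<open>The cardinal order of \<open>A\<close>, made strict: a recursion along \<open>R\<close>
  has fewer than \<open>|A|\<close> earlier choices to avoid at each stage. The bound covers every
  \<open>x\<close> of the type because such recursions define functions on the whole type.\<close>

lemma exists_initial_well_order:
  assumes inf: "infinite A"
  shows "\<exists>R. wf R \<and> trans R \<and> R \<subseteq> A \<times> A \<and>
    (\<forall>x\<in>A. \<forall>y\<in>A. x \<noteq> y \<longrightarrow> (x, y) \<in> R \<or> (y, x) \<in> R) \<and> (\<forall>x. |{y. (y, x) \<in> R}| <o |A| )"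
proof -
  define r where "r = |A|"
  have Fr: "Field r = A" and wo: "Well_order r" and Cr: "Card_order r"
    unfolding r_def by (auto simp: Field_card_of card_of_Well_order card_of_Card_order)
  define R where "R = r - Id"
  have wf: "wf R" using wo unfolding R_def well_order_on_def by blast
  have tot: "(x, y) \<in> R \<or> (y, x) \<in> R" if "x \<in> A" "y \<in> A" "x \<noteq> y" for x y
    using wo that Fr unfolding R_def well_order_on_def linear_order_on_def total_on_def by blast
  have "trans R"
    unfolding R_def using wo
    by (intro trans_diff_Id) (auto simp: well_order_on_def linear_order_on_def partial_order_on_def preorder_on_def)
  have below: "|{y. (y, x) \<in> R}| <o |A|" for x
  proof (cases "x \<in> A")
    case True
    then have "|underS r x| <o r"
      using card_of_underS[OF Cr] Fr by blast
    moreover have "{y. (y, x) \<in> R} = underS r x" by (auto simp: R_def underS_def)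
    ultimately show ?thesis by (simp add: r_def)
  next
    case False
    then have "{y. (y, x) \<in> R} = {}" using Fr by (auto simp: R_def Field_def)
    then show ?thesis by (simp add: finite_card_of_ordLess_infinite inf)
  qed
  moreover have "R \<subseteq> A \<times> A" using Fr by (auto simp: R_def Field_def)
  ultimately show ?thesis using wf tot \<open>trans R\<close> by blast
qed

text \<open>Serves to single out the last element that occurs in a relation, at which the relation
  is then refuted.\<close>

lemma finite_total_order_has_max:
  assumes "finite K" "K \<noteq> {}" "trans R"
    and "\<And>x y. x \<in> K \<Longrightarrow> y \<in> K \<Longrightarrow> x \<noteq> y \<Longrightarrow> (x, y) \<in> R \<or> (y, x) \<in> R"
  shows "\<exists>t\<in>K. \<forall>s\<in>K. s \<noteq> t \<longrightarrow> (s, t) \<in> R"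
  using assms
proof (induction K rule: finite_ne_induct)
  case (insert x K)
  then obtain t where t: "t \<in> K" "\<forall>s\<in>K. s \<noteq> t \<longrightarrow> (s, t) \<in> R" by auto
  have "x \<noteq> t" using t insert by blast
  then consider "(x, t) \<in> R" | "(t, x) \<in> R" using insert.prems t by blast
  then show ?case
  proof cases
    case 1 then show ?thesis using t by (intro bexI[of _ t]) auto
  next
    case 2
    then have "\<forall>s\<in>K. (s, x) \<in> R" using t \<open>trans R\<close> by (metis transD)
    then show ?thesis by (intro bexI[of _ x]) auto
  qed
qed simp

subsection \<open>Cliques and the sharp packing index\<close>

context comm_group
begin

definition gdiv :: "'a \<Rightarrow> 'a \<Rightarrow> 'a" (infixl \<open>\<oslash>\<close> 70) where
  "x \<oslash> y = x \<otimes> inv y"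

lemma gdiv_closed [simp, intro]: "x \<in> carrier G \<Longrightarrow> y \<in> carrier G \<Longrightarrow> x \<oslash> y \<in> carrier G"
  by (simp add: gdiv_def)

lemma gdiv_self [simp]: "x \<in> carrier G \<Longrightarrow> x \<oslash> x = \<one>"
  by (simp add: gdiv_def)

lemma gdiv_one [simp]: "x \<in> carrier G \<Longrightarrow> x \<oslash> \<one> = x"
  by (simp add: gdiv_def)

text \<open>
  Together with \<open>m_ac\<close>, these rules decide the identities of free Abelian groups, in the way
  \<open>field_simps\<close> does for fractions.
\<close>

lemma gdiv_simps:
  assumes "a \<in> carrier G" "b \<in> carrier G" "c \<in> carrier G"
  shows "inv a = \<one> \<oslash> a" "a \<otimes> (b \<oslash> c) = (a \<otimes> b) \<oslash> c" "(a \<oslash> b) \<otimes> c = (a \<otimes> c) \<oslash> b"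
    "(a \<oslash> b) \<oslash> c = a \<oslash> (b \<otimes> c)" "a \<oslash> (b \<oslash> c) = (a \<otimes> c) \<oslash> b"
    "a \<oslash> b = c \<longleftrightarrow> a = c \<otimes> b" "c = a \<oslash> b \<longleftrightarrow> c \<otimes> b = a"
  using assms by (auto simp: gdiv_def inv_mult m_ac inv_solve_right inv_solve_right')

lemma gdiv_eq_one_iff: "a \<in> carrier G \<Longrightarrow> b \<in> carrier G \<Longrightarrow> a \<oslash> b = \<one> \<longleftrightarrow> a = b"
  by (simp add: gdiv_simps)

text \<open>The difference set \<open>A - A\<close> in multiplicative notation.\<close>

definition quotients :: "'a set \<Rightarrow> 'a set" where
  "quotients A = {a \<oslash> a' |a a'. a \<in> A \<and> a' \<in> A}"

definition clique :: "'a set \<Rightarrow> 'a set \<Rightarrow> bool" where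
  "clique F B \<longleftrightarrow> B \<subseteq> carrier G \<and> (\<forall>b\<in>B. \<forall>b'\<in>B. b \<noteq> b' \<longrightarrow> b \<oslash> b' \<in> F)"

lemma disjoint_translates_iff:
  assumes "A \<subseteq> carrier G" "B \<subseteq> carrier G"
  shows "disjoint_family_on (\<lambda>b. b <# A) B \<longleftrightarrow> clique (carrier G - quotients A) B"
proof -
  have "(b <# A) \<inter> (b' <# A) = {} \<longleftrightarrow> b \<oslash> b' \<notin> quotients A"
    if "b \<in> B" "b' \<in> B" for b b'
  proof -
    have carr: "b \<in> carrier G" "b' \<in> carrier G" using that assms by auto
    have "(b <# A) \<inter> (b' <# A) = {} \<longleftrightarrow> (\<forall>a\<in>A. \<forall>a'\<in>A. b \<otimes> a \<noteq> b' \<otimes> a')"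
      unfolding l_coset_def by blast
    also have "\<dots> \<longleftrightarrow> (\<forall>a\<in>A. \<forall>a'\<in>A. b \<oslash> b' \<noteq> a' \<oslash> a)"
    proof (intro ball_cong refl)
      fix a a' assume "a \<in> A" "a' \<in> A"
      then have "a \<in> carrier G" "a' \<in> carrier G" using assms by auto
      then show "b \<otimes> a \<noteq> b' \<otimes> a' \<longleftrightarrow> b \<oslash> b' \<noteq> a' \<oslash> a"
        using carr by (simp add: gdiv_simps) (simp add: m_ac)
    qed
    finally show ?thesis by (auto simp: quotients_def)
  qed
  then show ?thesis
    using assms unfolding disjoint_family_on_def clique_def by (auto simp: subset_iff)
qed

text \<open>Each \<open>x\<close> outside \<open>F\<close> becomes a quotient through a pair
  \<open>f x\<close>, \<open>f x \<otimes> x\<close>, chosen so that no quotient with an earlier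
  point falls into \<open>F\<close>. As \<open>F\<close> is symmetric, only quotients of later by
  earlier points have to be controlled.\<close>

lemma exists_set_with_quotients:
  assumes inf: "infinite (carrier G)"
    and F: "F \<subseteq> carrier G" "\<one> \<notin> F" "\<And>f. f \<in> F \<Longrightarrow> inv f \<in> F"
    and sparse: "\<And>S. S \<subseteq> carrier G \<Longrightarrow> |S| <o |carrier G| \<Longrightarrow> \<exists>g\<in>carrier G. g \<notin> S <#> F"
  shows "\<exists>A\<subseteq>carrier G. quotients A = carrier G - F"
proof -
  obtain R where wf: "wf R" and R: "R \<subseteq> carrier G \<times> carrier G"
    and tot: "\<And>x y. x \<in> carrier G \<Longrightarrow> y \<in> carrier G \<Longrightarrow> x \<noteq> y \<Longrightarrow> (x, y) \<in> R \<or> (y, x) \<in> R"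
    and below: "\<And>x. |{y. (y, x) \<in> R}| <o |carrier G|"
    using exists_initial_well_order[OF inf] by metis
  \<comment> \<open>The points of the pairs adjoined before stage \<open>x\<close>; stages
    \<open>y \<in> F\<close> adjoin nothing.\<close>
  define used where "used f x = (\<Union>y\<in>{y. (y, x) \<in> R \<and> y \<notin> F}. {f y, f y \<otimes> y})" for f :: "'a \<Rightarrow> 'a" and x
  have "\<exists>f. \<forall>x. f x \<in> carrier G \<and> (x \<in> carrier G \<longrightarrow>
      (\<forall>s \<in> used f x. f x \<oslash> s \<notin> F \<and> f x \<otimes> x \<oslash> s \<notin> F))"
  proof (rule dependent_wf_choice[OF wf], goal_cases)
    case (1 f g x r)
    then have "used f x = used g x" unfolding used_def by auto
    then show ?case by simp
  next
    case (2 x f)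
    show ?case
    proof (cases "x \<in> carrier G")
      case True
      \<comment> \<open>The first point must avoid the translate of \<open>F\<close> by
        \<open>s\<close>; the second does so iff the first avoids the translate by
        \<open>s \<otimes> inv x\<close>.\<close>
      let ?S = "used f x \<union> (\<lambda>s. s \<otimes> inv x) ` used f x"
      have lt: "|used f x| <o |carrier G|"
      proof -
        have "used f x \<subseteq> (\<lambda>(y, b). if b then f y else f y \<otimes> y) ` ({y. (y, x) \<in> R} \<times> (UNIV :: bool set))"
        proof
          fix s assume "s \<in> used f x"
          then obtain y where "(y, x) \<in> R" "s = f y \<or> s = f y \<otimes> y" unfolding used_def by blast
          then show "s \<in> (\<lambda>(y, b). if b then f y else f y \<otimes> y) ` ({y. (y, x) \<in> R} \<times> (UNIV :: bool set))"
            by (intro image_eqI[where x = "(y, s = f y)"]) auto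
        qed
        moreover have "|{y. (y, x) \<in> R} \<times> (UNIV :: bool set)| <o |carrier G|"
          by (intro card_of_Times_ordLess_infinite below inf finite_card_of_ordLess_infinite) auto
        ultimately show ?thesis
          by (rule card_of_subset_ordLess[OF _ card_of_image_ordLess])
      qed
      have usedc: "used f x \<subseteq> carrier G"
      proof -
        have "y \<in> carrier G" "f y \<in> carrier G" if "(y, x) \<in> R" for y
          using that 2 R by auto
        then show ?thesis unfolding used_def by auto
      qed
      then have "?S \<subseteq> carrier G" using True by auto
      moreover have "|?S| <o |carrier G|"
        by (intro card_of_Un_ordLess_infinite inf lt card_of_image_ordLess)
      ultimately obtain g where g: "g \<in> carrier G" "g \<notin> ?S <#> F" using sparse by blast
      have "g \<oslash> s \<notin> F \<and> g \<otimes> x \<oslash> s \<notin> F" if s: "s \<in> used f x" for s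
      proof -
        have sc: "s \<in> carrier G" using s usedc by blast
        have "g = s \<otimes> (g \<oslash> s)" "g = s \<otimes> inv x \<otimes> (g \<otimes> x \<oslash> s)"
          using g(1) sc True by (simp_all add: gdiv_simps m_ac)
        then show ?thesis using g(2) s unfolding set_mult_def by blast
      qed
      then show ?thesis using g(1) by blast
    qed auto
  qed
  then obtain f where fc: "\<And>x. f x \<in> carrier G"
    and f: "\<And>x s. x \<in> carrier G \<Longrightarrow> s \<in> used f x \<Longrightarrow> f x \<oslash> s \<notin> F \<and> f x \<otimes> x \<oslash> s \<notin> F"
    by blast
  define A where "A = (\<Union>x\<in>carrier G - F. {f x, f x \<otimes> x})"
  have Ac: "A \<subseteq> carrier G" using fc unfolding A_def by auto
  have "x \<in> quotients A" if "x \<in> carrier G - F" for x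
  proof -
    have "x = (f x \<otimes> x) \<oslash> f x" using that fc[of x] by (simp add: gdiv_simps m_ac)
    then show ?thesis using that unfolding quotients_def A_def by blast
  qed
  moreover have "a \<oslash> a' \<notin> F" if a: "a \<in> A" "a' \<in> A" for a a'
  proof -
    obtain x y where x: "x \<in> carrier G - F" "a \<in> {f x, f x \<otimes> x}"
      and y: "y \<in> carrier G - F" "a' \<in> {f y, f y \<otimes> y}" using a unfolding A_def by blast
    have ac: "a \<in> carrier G" "a' \<in> carrier G" using a Ac by auto
    \<comment> \<open>Within one pair the quotients are \<one>, \<open>x\<close> and
      \<open>inv x\<close>. Between two pairs the later stage has excluded \<open>F\<close>,
      directly or by symmetry.\<close>
    consider "x = y" | "(y, x) \<in> R" | "(x, y) \<in> R" using tot x y by blast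
    then show ?thesis
    proof cases
      case 1
      have "inv x \<notin> F" using F(3)[of "inv x"] x by auto
      moreover have "f x \<oslash> (f x \<otimes> x) = inv x" "f x \<otimes> x \<oslash> f x = x"
        using x fc[of x] by (simp_all add: gdiv_simps m_ac)
      ultimately show ?thesis using x y 1 fc[of x] F(2) by auto
    next
      case 2
      then have "a' \<in> used f x" unfolding used_def using y by blast
      then show ?thesis using f[of x a'] x by auto
    next
      case 3
      then have "a \<in> used f y" unfolding used_def using x by blast
      then have "a' \<oslash> a \<notin> F" using f[of y a] y by auto
      moreover have "inv (a \<oslash> a') = a' \<oslash> a" using ac by (simp add: gdiv_simps m_ac)
      ultimately show ?thesis using F(3)[of "a \<oslash> a'"] by auto
    qed
  qed
  ultimately have "quotients A = carrier G - F"
    using Ac unfolding quotients_def by auto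
  then show ?thesis using Ac by blast
qed

section \<open>The index in terms of clique sizes\<close>

lemma clique_subset: "clique F B \<Longrightarrow> C \<subseteq> B \<Longrightarrow> clique F C"
  unfolding clique_def by blast

text \<open>The index is the least cardinal above the sizes of all cliques. Testing smaller
  cardinals on \<open>'a set\<close> is enough because the index itself lives on that type.\<close>

lemma sharp_packing_index_ordIso_iff:
  fixes \<kappa> :: "'k rel"
  assumes A: "A \<subseteq> carrier G" and \<kappa>: "Card_order \<kappa>"
  defines "F \<equiv> carrier G - quotients A"
  shows "sharp_packing_index G A =o \<kappa> \<longleftrightarrow>
    (\<forall>C. clique F C \<longrightarrow> |C| <o \<kappa>) \<and>
    (\<forall>\<mu> :: 'a set rel. Card_order \<mu> \<and> \<mu> <o \<kappa> \<longrightarrow> (\<exists>C. clique F C \<and> \<mu> \<le>o |C| ))"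
proof -
  have np: "no_packing_of_size G A \<mu> \<longleftrightarrow> (\<forall>C. clique F C \<longrightarrow> \<not> \<mu> \<le>o |C| )" for \<mu> :: "'x rel"
  proof -
    have "C \<subseteq> carrier G" if "clique F C" for C using that by (simp add: clique_def)
    moreover have "disjoint_family_on (\<lambda>b. b <# A) C \<longleftrightarrow> clique F C" if "C \<subseteq> carrier G" for C
      unfolding F_def by (rule disjoint_translates_iff[OF A that])
    ultimately show ?thesis unfolding no_packing_of_size_def by metis
  qed
  have less: "\<not> \<mu> \<le>o |C| \<longleftrightarrow> |C| <o \<mu>" if "Card_order \<mu>" for \<mu> :: "'x rel" and C :: "'a set"
    by (rule not_ordLeq_iff_ordLess) (rule card_order_on_well_order_on[OF that] card_of_Well_order)+
  let ?p = "sharp_packing_index G A"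
  have p: "Card_order ?p" by (rule Card_order_sharp_packing_index)
  have wo: "Well_order ?p" "Well_order \<kappa>"
    by (rule card_order_on_well_order_on[OF p] card_order_on_well_order_on[OF \<kappa>])+
  show ?thesis
  proof
    assume eq: "?p =o \<kappa>"
    then have "no_packing_of_size G A \<kappa>"
      by (rule no_packing_of_size_cong) (rule no_packing_of_size_sharp_packing_index)
    moreover have "\<exists>C. clique F C \<and> \<mu> \<le>o |C|" if "Card_order \<mu>" "\<mu> <o \<kappa>" for \<mu> :: "'a set rel"
    proof (rule ccontr)
      assume "\<not> (\<exists>C. clique F C \<and> \<mu> \<le>o |C| )"
      then have "no_packing_of_size G A \<mu>" by (simp add: np)
      then have "?p \<le>o \<mu>" using that sharp_packing_index_least by blast
      then have "\<kappa> \<le>o \<mu>" using ordIso_ordLeq_iff(1)[OF eq] by blast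
      then show False using that not_ordLess_ordLeq by blast
    qed
    ultimately show "(\<forall>C. clique F C \<longrightarrow> |C| <o \<kappa>) \<and>
        (\<forall>\<mu> :: 'a set rel. Card_order \<mu> \<and> \<mu> <o \<kappa> \<longrightarrow> (\<exists>C. clique F C \<and> \<mu> \<le>o |C| ))"
      using np[of \<kappa>] less[OF \<kappa>] by blast
  next
    assume R: "(\<forall>C. clique F C \<longrightarrow> |C| <o \<kappa>) \<and>
        (\<forall>\<mu> :: 'a set rel. Card_order \<mu> \<and> \<mu> <o \<kappa> \<longrightarrow> (\<exists>C. clique F C \<and> \<mu> \<le>o |C| ))"
    then have "no_packing_of_size G A \<kappa>" using np[of \<kappa>] less[OF \<kappa>] by blast
    then have "?p \<le>o \<kappa>" by (rule sharp_packing_index_least[OF \<kappa>])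
    moreover have "\<not> ?p <o \<kappa>"
    proof
      assume "?p <o \<kappa>"
      then obtain C where "clique F C" "?p \<le>o |C|" using R p by blast
      then show False using no_packing_of_size_sharp_packing_index[of G A] np[of ?p] by blast
    qed
    ultimately show "?p =o \<kappa>" using ordLeq_iff_ordLess_or_ordIso by blast
  qed
qed

text \<open>The index is the first size without a clique, so \<open>Suc n\<close> belongs to the
  maximal clique size \<open>n\<close>. A clique that is at least that large can be cut down to
  \<open>n\<close> elements.\<close>

lemma sharp_packing_index_natLeq_on_iff:
  assumes A: "A \<subseteq> carrier G" and inf: "infinite (carrier G)"
  defines "F \<equiv> carrier G - quotients A"
  shows "sharp_packing_index G A =o natLeq_on (Suc n) \<longleftrightarrow>
    (\<forall>C. clique F C \<longrightarrow> finite C \<and> card C \<le> n) \<and> (\<exists>C. clique F C \<and> finite C \<and> card C = n)"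
    (is "?l \<longleftrightarrow> ?r1 \<and> ?r2")
proof -
  have "?r2 \<longleftrightarrow> (\<forall>\<mu> :: 'a set rel. Card_order \<mu> \<and> \<mu> <o natLeq_on (Suc n) \<longrightarrow>
      (\<exists>C. clique F C \<and> \<mu> \<le>o |C| ))" (is "_ \<longleftrightarrow> ?r3")
  proof
    assume ?r2
    then obtain C where C: "clique F C" "finite C" "card C = n" by blast
    show ?r3
    proof (intro allI impI exI conjI)
      show "clique F C" by fact
      fix \<mu> :: "'a set rel" assume \<mu>: "Card_order \<mu> \<and> \<mu> <o natLeq_on (Suc n)"
      have eq: "|Field \<mu>| =o \<mu>" using \<mu> card_of_Field_ordIso by blast
      then have "|Field \<mu>| <o natLeq_on (Suc n)" using \<mu> ordIso_ordLess_trans by blast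
      then have "finite (Field \<mu>)" "card (Field \<mu>) \<le> card C"
        using C by (auto simp: card_of_ordLess_natLeq_on_iff)
      then have "|Field \<mu>| \<le>o |C|"
        using C by (simp add: card_of_ordLeq[symmetric] inj_on_iff_card_le)
      then show "\<mu> \<le>o |C|" using ordIso_ordLeq_iff(1)[OF eq] by blast
    qed
  next
    assume r3: ?r3
    obtain Y where Y: "finite Y" "card Y = n" "Y \<subseteq> carrier G"
      using infinite_arbitrarily_large[OF inf] by blast
    \<comment> \<open>Singletons give \<open>n\<close> elements of type \<open>'a set\<close>, so
      that \<open>|X|\<close> has the type over which \<open>\<mu>\<close> ranges.\<close>
    define X where "X = (\<lambda>x. {x}) ` Y"
    have X: "finite X" "card X = n" using Y by (auto simp: X_def card_image)
    then have "|X| <o natLeq_on (Suc n)" by (simp add: card_of_ordLess_natLeq_on_iff)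
    then obtain C where C: "clique F C" "|X| \<le>o |C|" using r3 card_of_Card_order by blast
    then have "natLeq_on n \<le>o |C|"
      by (simp add: ordIso_ordLeq_iff(1)[OF card_of_natLeq_on_card[OF X(1)]] X(2))
    then have "infinite C \<or> n \<le> card C" by (auto simp: natLeq_on_ordLeq_card_of_iff)
    then obtain D where "D \<subseteq> C" "finite D" "card D = n"
      by (meson infinite_arbitrarily_large obtain_subset_with_card_n finite_subset)
    then show ?r2 using C clique_subset by blast
  qed
  moreover have "?r1 \<longleftrightarrow> (\<forall>C. clique F C \<longrightarrow> |C| <o natLeq_on (Suc n))"
    unfolding card_of_ordLess_natLeq_on_iff by (metis less_Suc_eq_le)
  ultimately show ?thesis
    unfolding F_def sharp_packing_index_ordIso_iff[OF A Card_order_natLeq_on] by blast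
qed

lemma exists_sharp_packing_index:
  fixes \<kappa> :: "'k rel"
  assumes inf: "infinite (carrier G)" and \<kappa>: "Card_order \<kappa>"
    and F: "F \<subseteq> carrier G" "\<one> \<notin> F" "\<And>f. f \<in> F \<Longrightarrow> inv f \<in> F"
    and sparse: "\<And>S. S \<subseteq> carrier G \<Longrightarrow> |S| <o |carrier G| \<Longrightarrow> \<exists>g\<in>carrier G. g \<notin> S <#> F"
    and "\<And>C. clique F C \<Longrightarrow> |C| <o \<kappa>"
    and "\<And>\<mu> :: 'a set rel. Card_order \<mu> \<Longrightarrow> \<mu> <o \<kappa> \<Longrightarrow> \<exists>C. clique F C \<and> \<mu> \<le>o |C|"
  shows "\<exists>A\<subseteq>carrier G. sharp_packing_index G A =o \<kappa>"
proof -
  obtain A where A: "A \<subseteq> carrier G" "quotients A = carrier G - F"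
    using exists_set_with_quotients[OF inf F sparse] by blast
  have "carrier G - quotients A = F" using A(2) F by blast
  then have "sharp_packing_index G A =o \<kappa>"
    by (simp only: sharp_packing_index_ordIso_iff[OF A(1) \<kappa>]) (simp add: assms(7,8))
  then show ?thesis using A(1) by blast
qed

text \<open>A finite \<open>F\<close> is sparse: fewer than \<open>|carrier G|\<close> translates of
  it have fewer than \<open>|carrier G|\<close> elements in total.\<close>

lemma exists_sharp_packing_index_finite:
  assumes inf: "infinite (carrier G)"
    and F: "F \<subseteq> carrier G" "\<one> \<notin> F" "\<And>f. f \<in> F \<Longrightarrow> inv f \<in> F" "finite F"
    and "\<And>C. clique F C \<Longrightarrow> finite C \<and> card C \<le> n"
    and "clique F C" "finite C" "card C = n"
  shows "\<exists>A\<subseteq>carrier G. sharp_packing_index G A =o natLeq_on (Suc n)"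
proof -
  have "\<exists>g\<in>carrier G. g \<notin> S <#> F" if "S \<subseteq> carrier G" "|S| <o |carrier G|" for S
  proof -
    have "S <#> F = (\<lambda>(s, f). s \<otimes> f) ` (S \<times> F)" by (auto simp: set_mult_def)
    then have "|S <#> F| <o |carrier G|"
      using card_of_image_ordLess[OF card_of_Times_ordLess_infinite[OF inf that(2)
          finite_card_of_ordLess_infinite[OF F(4) inf]]] by simp
    then have "\<not> carrier G \<subseteq> S <#> F" using card_of_mono1 not_ordLess_ordLeq by blast
    then show ?thesis by blast
  qed
  then obtain A where A: "A \<subseteq> carrier G" "quotients A = carrier G - F"
    using exists_set_with_quotients[OF inf F(1,2,3)] by blast
  have "carrier G - quotients A = F" using A(2) F by blast
  then have "sharp_packing_index G A =o natLeq_on (Suc n)"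
    by (simp only: sharp_packing_index_natLeq_on_iff[OF A(1) inf]) (use assms(6-) in blast)
  then show ?thesis using A(1) by blast
qed

text \<open>Dividing by a member \<open>c\<close> changes no quotient, so a clique may be assumed to
  contain \<one>.\<close>

lemma clique_translate:
  assumes "clique F C" "c \<in> C"
  shows "clique F ((\<lambda>x. x \<oslash> c) ` C)" "inj_on (\<lambda>x. x \<oslash> c) C"
    "(\<lambda>x. x \<oslash> c) ` C - {\<one>} \<subseteq> F" "\<one> \<in> (\<lambda>x. x \<oslash> c) ` C"
proof -
  have carr: "x \<in> carrier G" if "x \<in> C" for x using that assms unfolding clique_def by blast
  have "(x \<oslash> c) \<oslash> (y \<oslash> c) = x \<oslash> y" if "x \<in> C" "y \<in> C" for x y
    using carr[OF that(1)] carr[OF that(2)] carr[OF assms(2)] by (simp add: gdiv_simps m_ac)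
  then show "clique F ((\<lambda>x. x \<oslash> c) ` C)"
    using assms carr unfolding clique_def by auto
  show "inj_on (\<lambda>x. x \<oslash> c) C"
    using carr assms(2) by (intro inj_onI) (simp add: gdiv_def)
  show "(\<lambda>x. x \<oslash> c) ` C - {\<one>} \<subseteq> F"
    using assms carr gdiv_self by (fastforce simp: clique_def)
  show "\<one> \<in> (\<lambda>x. x \<oslash> c) ` C"
    using assms(2) carr gdiv_self by (metis image_eqI)
qed

lemma card_clique_le_translate:
  assumes "\<And>D. clique F D \<Longrightarrow> \<one> \<in> D \<Longrightarrow> D - {\<one>} \<subseteq> F \<Longrightarrow> finite D \<and> card D \<le> n" "clique F C"
  shows "finite C \<and> card C \<le> n"
proof (cases "C = {}")
  case False
  then obtain c where c: "c \<in> C" by blast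
  note tr = clique_translate[OF assms(2) c]
  have "finite ((\<lambda>x. x \<oslash> c) ` C) \<and> card ((\<lambda>x. x \<oslash> c) ` C) \<le> n"
    by (rule assms(1)[OF tr(1,4,3)])
  then show ?thesis using tr(2) by (auto simp: card_image dest: finite_imageD)
qed simp

subsection \<open>Independent sets\<close>

text \<open>\<open>torsion 0\<close> is the whole group, so \<open>r = 0\<close> covers the case
  without a bound on the orders.\<close>

definition torsion :: "int \<Rightarrow> 'a set" where
  "torsion k = {x \<in> carrier G. x [^] k = \<one>}"

text \<open>Products of at most \<open>n\<close> powers of elements of \<open>S\<close>. In a
  relation with three factors on each side every coefficient lies between -3 and 3, whence the range
  of exponents.\<close>

primrec words :: "nat \<Rightarrow> 'a set \<Rightarrow> 'a set" where
  "words 0 S = {\<one>}"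
| "words (Suc n) S = words n S \<union> (\<lambda>(w, s, k). w \<otimes> s [^] k) ` (words n S \<times> S \<times> {-3..3 :: int})"

lemma words_mono: "m \<le> n \<Longrightarrow> words m S \<subseteq> words n S"
  by (induction n) (auto simp: le_Suc_eq)

lemma card_of_words_ordLess:
  assumes "infinite (carrier G)" "|S| <o |carrier G|"
  shows "|words n S| <o |carrier G|"
proof (induction n)
  case 0
  then show ?case by (simp add: finite_card_of_ordLess_infinite assms)
next
  case (Suc n)
  show ?case unfolding words.simps
    by (intro card_of_Un_ordLess_infinite card_of_image_ordLess card_of_Times_ordLess_infinite Suc assms)
      (simp add: finite_card_of_ordLess_infinite assms)
qed

lemma finprod_mem_words:
  assumes "finite K" "K \<subseteq> S" "S \<subseteq> carrier G" "\<And>e. e \<in> K \<Longrightarrow> f e \<in> {-3..3 :: int}"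
  shows "finprod G (\<lambda>e. e [^] f e) K \<in> words (card K) S"
  using assms
proof (induction K)
  case (insert e K)
  have "finprod G (\<lambda>e. e [^] f e) (insert e K) = e [^] f e \<otimes> finprod G (\<lambda>e. e [^] f e) K"
    using insert by (intro finprod_insert) (auto simp: subset_iff)
  moreover have "finprod G (\<lambda>e. e [^] f e) K \<in> carrier G"
    using insert by (intro finprod_closed) (auto simp: subset_iff)
  ultimately have *: "finprod G (\<lambda>e. e [^] f e) (insert e K) = finprod G (\<lambda>e. e [^] f e) K \<otimes> e [^] f e"
    using insert by (simp add: m_comm subset_iff)
  have "finprod G (\<lambda>e. e [^] f e) K \<in> words (card K) S" using insert by simp
  then have "finprod G (\<lambda>e. e [^] f e) K \<otimes> e [^] f e \<in>
      (\<lambda>(w, s, k). w \<otimes> s [^] k) ` (words (card K) S \<times> S \<times> {-3..3 :: int})"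
    using insert by (intro image_eqI[where x = "(finprod G (\<lambda>e. e [^] f e) K, e, f e)"]) auto
  then show ?case using insert * by simp
qed simp

lemma torsion_coprime:
  assumes "x \<in> carrier G" "x [^] m = \<one>" "x [^] n = \<one>" "coprime m (n :: int)"
  shows "x = \<one>"
proof -
  obtain u v where "u * m + v * n = 1"
    using assms(4) by (metis bezout_int coprime_iff_gcd_eq_1)
  then have "x = x [^] (m * u + n * v)" using assms by (simp add: mult.commute)
  also have "\<dots> = (x [^] m) [^] u \<otimes> (x [^] n) [^] v"
    using assms(1) by (simp add: int_pow_mult int_pow_pow)
  finally show ?thesis using assms by simp
qed

lemma torsion_coprime_Int: "coprime m n \<Longrightarrow> {x \<in> torsion m. x [^] n = \<one>} = {\<one>}"
  using torsion_coprime by (auto simp: torsion_def)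

text \<open>
  \<open>r\<close> is \<open>2\<close> or \<open>3\<close> if \<open>G\<close> has \<open>|G|\<close> elements of that exponent; otherwise doubling and tripling have
  small fibres on all of \<open>G = torsion 0\<close>.
\<close>

lemma exists_large_torsion:
  assumes inf: "infinite (carrier G)"
  shows "\<exists>r\<in>{0, 2, 3}. |carrier G| \<le>o |torsion r| \<and>
    (\<forall>k\<in>{1, 2, 3}. \<not> r dvd k \<longrightarrow> |{x \<in> torsion r. x [^] k = \<one>}| <o |carrier G| )"
proof -
  have le: "|carrier G| \<le>o |torsion k|" if "\<not> |torsion k| <o |carrier G|" for k
    using that by simp
  have one: "|{\<one>}| <o |carrier G|" by (simp add: finite_card_of_ordLess_infinite inf)
  consider "\<not> |torsion 2| <o |carrier G|" | "\<not> |torsion 3| <o |carrier G|"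
    | "|torsion 2| <o |carrier G|" "|torsion 3| <o |carrier G|" by blast
  then show ?thesis
  proof cases
    case 1
    have "coprime (2 :: int) 1" "coprime (2 :: int) 3" by simp_all
    then show ?thesis using le[OF 1] one by (intro bexI[of _ 2]) (simp_all add: torsion_coprime_Int)
  next
    case 2
    have "coprime (3 :: int) 1" "coprime (3 :: int) 2" by simp_all
    then show ?thesis using le[OF 2] one by (intro bexI[of _ 3]) (simp_all add: torsion_coprime_Int)
  next
    case 3
    have "torsion 0 = carrier G" by (auto simp: torsion_def)
    moreover have "{x \<in> carrier G. x [^] (1 :: int) = \<one>} = {\<one>}" by auto
    ultimately show ?thesis using 3 one
      by (intro bexI[of _ 0]) (auto simp: torsion_def card_of_refl)
  qed
qed

text \<open>Elements of \<open>torsion r\<close> with the same \<open>k\<close>-th power differ by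
  an element of the kernel, so the preimage of \<open>W\<close> is covered by one translate of the
  kernel for each member of \<open>W\<close>.\<close>

lemma card_of_power_fibre_ordLess:
  assumes inf: "infinite (carrier G)" and "|W| <o |carrier G|"
    and "|{x \<in> torsion r. x [^] k = \<one>}| <o |carrier G|"
  shows "|{x \<in> torsion r. x [^] (k :: int) \<in> W}| <o |carrier G|"
proof -
  define rep where "rep w = (SOME x. x \<in> torsion r \<and> x [^] k = w)" for w
  have "{x \<in> torsion r. x [^] k \<in> W} \<subseteq>
      (\<lambda>(w, z). rep w \<otimes> z) ` (W \<times> {x \<in> torsion r. x [^] k = \<one>})"
  proof
    fix x assume x: "x \<in> {x \<in> torsion r. x [^] k \<in> W}"
    define t where "t = rep (x [^] k)"
    have t: "t \<in> torsion r" "t [^] k = x [^] k"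
      using someI[of "\<lambda>y. y \<in> torsion r \<and> y [^] k = x [^] k" x] x by (auto simp: t_def rep_def)
    have carr: "t \<in> carrier G" "x \<in> carrier G" using t x by (auto simp: torsion_def)
    have "x \<oslash> t \<in> torsion r" "(x \<oslash> t) [^] k = \<one>"
      using carr t x by (simp_all add: torsion_def gdiv_def int_pow_distrib int_pow_inv)
    moreover have "x = t \<otimes> (x \<oslash> t)" using carr by (simp add: gdiv_simps m_comm)
    ultimately show "x \<in> (\<lambda>(w, z). rep w \<otimes> z) ` (W \<times> {x \<in> torsion r. x [^] k = \<one>})"
      using x unfolding t_def by (intro image_eqI[where x = "(x [^] k, x \<oslash> rep (x [^] k))"]) auto
  qed
  then show ?thesis
    by (rule card_of_subset_ordLess)
      (intro card_of_image_ordLess card_of_Times_ordLess_infinite assms)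
qed

text \<open>
  The divisibility says that both sides of the relation agree as elements of the free \<open>\<int>\<^sub>r\<close>-module
  on \<open>E\<close>; for \<open>r = 0\<close> it is equality of the coefficients.
\<close>

definition independent :: "int \<Rightarrow> 'a set \<Rightarrow> bool" where
  "independent r E \<longleftrightarrow> (\<forall>a\<in>E. \<forall>b\<in>E. \<forall>c\<in>E. \<forall>d\<in>E. \<forall>x\<in>E. \<forall>y\<in>E.
     a \<otimes> c \<otimes> x = b \<otimes> d \<otimes> y \<longrightarrow>
     (\<forall>e. r dvd of_bool (a = e) + of_bool (c = e) + of_bool (x = e)
         - (of_bool (b = e) + of_bool (d = e) + of_bool (y = e))))"

text \<open>Turns a product of three elements into its coefficients over \<open>K\<close>;
  coincidences among \<open>a\<close>, \<open>b\<close>, \<open>c\<close> add up in the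
  exponent.\<close>

lemma finprod_indicators:
  assumes "finite K" "K \<subseteq> carrier G" "a \<in> K" "b \<in> K" "c \<in> K"
  shows "finprod G (\<lambda>e. e [^] (of_bool (a = e) + of_bool (b = e) + of_bool (c = e) :: int)) K = a \<otimes> b \<otimes> c"
proof -
  have one: "finprod G (\<lambda>e. e [^] (of_bool (u = e) :: int)) K = u" if "u \<in> K" for u
  proof -
    have "finprod G (\<lambda>e. e [^] (of_bool (u = e) :: int)) K = finprod G (\<lambda>e. if u = e then e else \<one>) K"
      using assms by (intro finprod_cong') auto
    also have "\<dots> = u" using assms that finprod_singleton[of u K "\<lambda>e. e"] by auto
    finally show ?thesis .
  qed
  have pow: "e [^] (of_bool P :: int) \<in> carrier G" if "e \<in> K" for e P
    using that assms by auto
  have "finprod G (\<lambda>e. e [^] (of_bool (a = e) + of_bool (b = e) + of_bool (c = e) :: int)) K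
      = finprod G (\<lambda>e. e [^] (of_bool (a = e) :: int) \<otimes> e [^] (of_bool (b = e) :: int) \<otimes> e [^] (of_bool (c = e) :: int)) K"
    using assms by (intro finprod_cong') (auto simp: int_pow_mult subset_iff)
  also have "\<dots> = a \<otimes> b \<otimes> c"
    using assms pow by (simp add: finprod_multf one Pi_iff)
  finally show ?thesis .
qed

text \<open>
  Choose the elements of \<open>E\<close> one by one such that no multiple by \<open>k \<in> {1, 2, 3}\<close>, \<open>k\<close> not divisible by
  \<open>r\<close>, is a short word in the previous ones; then the last element of a nontrivial relation gives a
  contradiction.
\<close>

lemma exists_independent:
  assumes inf: "infinite (carrier G)"
  shows "\<exists>r\<in>{0, 2, 3}. \<exists>E. E \<subseteq> torsion r \<and> |E| =o |carrier G| \<and> independent r E"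
proof -
  obtain r where r: "r \<in> {0, 2, 3}" "|carrier G| \<le>o |torsion r|"
    and ker: "\<And>k. k \<in> {1, 2, 3} \<Longrightarrow> \<not> r dvd k \<Longrightarrow> |{x \<in> torsion r. x [^] k = \<one>}| <o |carrier G|"
    using exists_large_torsion[OF inf] by blast
  obtain R where wf: "wf R" and R: "R \<subseteq> carrier G \<times> carrier G" and trans: "trans R"
    and tot: "\<And>x y. x \<in> carrier G \<Longrightarrow> y \<in> carrier G \<Longrightarrow> x \<noteq> y \<Longrightarrow> (x, y) \<in> R \<or> (y, x) \<in> R"
    and below: "\<And>x. |{y. (y, x) \<in> R}| <o |carrier G|"
    using exists_initial_well_order[OF inf] by metis
  \<comment> \<open>A relation involves at most six elements, so \<open>words 6\<close> contains
    whatever the others contribute. Multiples \<open>k\<close> divisible by \<open>r\<close> are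
    exempt, as they vanish on \<open>torsion r\<close>.\<close>
  define good where "good S t \<longleftrightarrow> t \<in> torsion r \<and>
      (\<forall>k\<in>{1, 2, 3}. \<not> r dvd k \<longrightarrow> t [^] k \<notin> words 6 S)" for S t
  have ex_good: "\<exists>t. good S t" if "S \<subseteq> carrier G" "|S| <o |carrier G|" for S
  proof -
    let ?bad = "\<lambda>k. {x \<in> torsion r. \<not> r dvd k \<and> x [^] k \<in> words 6 S}"
    have bad: "|?bad k| <o |carrier G|" if k: "k \<in> {1, 2, 3}" for k
    proof (cases "r dvd k")
      case True
      then show ?thesis by (simp add: finite_card_of_ordLess_infinite inf)
    next
      case False
      then show ?thesis
        using card_of_power_fibre_ordLess[OF inf card_of_words_ordLess[OF inf \<open>|S| <o _\<close>] ker[OF k False]]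
        by simp
    qed
    have "|?bad 1 \<union> (?bad 2 \<union> ?bad 3)| <o |carrier G|"
      by (intro card_of_Un_ordLess_infinite inf bad) simp_all
    then have "\<not> torsion r \<subseteq> ?bad 1 \<union> (?bad 2 \<union> ?bad 3)"
      using ordLeq_transitive[OF r(2) card_of_mono1] not_ordLess_ordLeq by blast
    then show ?thesis unfolding good_def by blast
  qed
  have "\<exists>f. \<forall>x. f x \<in> torsion r \<and> good (f ` {y. (y, x) \<in> R}) (f x)"
  proof (rule dependent_wf_choice[OF wf], goal_cases)
    case (1 f g x t)
    then have "f ` {y. (y, x) \<in> R} = g ` {y. (y, x) \<in> R}" by auto
    then show ?case by simp
  next
    case (2 x f)
    then have "f ` {y. (y, x) \<in> R} \<subseteq> carrier G" by (auto simp: torsion_def)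
    then obtain t where "good (f ` {y. (y, x) \<in> R}) t"
      using ex_good card_of_image_ordLess[OF below] by blast
    then show ?case unfolding good_def by blast
  qed
  then obtain f where f: "\<And>x. good (f ` {y. (y, x) \<in> R}) (f x)" and ft: "\<And>x. f x \<in> torsion r" by blast
  have fc: "f x \<in> carrier G" for x using ft by (simp add: torsion_def)
  have neq: "f y \<noteq> f x" if "(y, x) \<in> R" for x y
  proof -
    let ?S = "f ` {y. (y, x) \<in> R}"
    \<comment> \<open>An earlier value is a word of length one, so the clause \<open>k = 1\<close>
      of \<open>good\<close> makes every value new.\<close>
    have "\<one> \<otimes> f y [^] (1 :: int) \<in> words (Suc 0) ?S"
      using that by force
    then have "f y [^] (1 :: int) \<in> words 6 ?S" using words_mono[of "Suc 0" 6 ?S] fc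
      by (simp del: words.simps add: subset_iff)
    moreover have "\<not> r dvd 1" using r by auto
    ultimately show ?thesis using f[of x] unfolding good_def by force
  qed
  define E where "E = f ` carrier G"
  have inj: "inj_on f (carrier G)" using neq tot by (metis inj_onI)
  then have "|E| =o |carrier G|" unfolding E_def
    by (meson bij_betw_imageI card_of_ordIso ordIso_symmetric)
  moreover have "independent r E"
    unfolding independent_def
  proof (intro ballI impI allI, rule ccontr)
    fix a b c d x y e
    assume mem: "a \<in> E" "b \<in> E" "c \<in> E" "d \<in> E" "x \<in> E" "y \<in> E"
      and eq: "a \<otimes> c \<otimes> x = b \<otimes> d \<otimes> y"
    \<comment> \<open>\<open>g\<close> holds the coefficients of the relation, left side minus right
      side; \<open>K'\<close> is their support modulo \<open>r\<close>.\<close>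
    define P :: "'a \<Rightarrow> int" where "P e = of_bool (a = e) + of_bool (c = e) + of_bool (x = e)" for e
    define N :: "'a \<Rightarrow> int" where "N e = of_bool (b = e) + of_bool (d = e) + of_bool (y = e)" for e
    define g :: "'a \<Rightarrow> int" where "g e = P e - N e" for e
    define K where "K = {a, b, c, d, x, y}"
    define K' where "K' = {e \<in> K. \<not> r dvd g e}"
    assume "\<not> r dvd of_bool (a = e) + of_bool (c = e) + of_bool (x = e)
         - (of_bool (b = e) + of_bool (d = e) + of_bool (y = e))"
    then have "\<not> r dvd g e" by (simp add: g_def P_def N_def)
    moreover have "g e = 0" if "e \<notin> K" using that by (auto simp: K_def g_def P_def N_def)
    ultimately have "e \<in> K'" unfolding K'_def by (metis (mono_tags) dvd_0_right mem_Collect_eq)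
    then have "K' \<noteq> {}" by blast
    have finK: "finite K" "card K \<le> 6"
      using card_length[of "[a, b, c, d, x, y]"] by (simp_all add: K_def)
    have KE: "K \<subseteq> E" using mem by (auto simp: K_def)
    have Ec: "E \<subseteq> carrier G" using fc by (auto simp: E_def)
    have Et: "E \<subseteq> torsion r" using ft by (auto simp: E_def)
    have bound: "g e \<in> {-3..3}" for e by (auto simp: g_def P_def N_def)
    have prodK: "finprod G (\<lambda>e. e [^] g e) K = \<one>"
    proof -
      have Kc: "K \<subseteq> carrier G" using KE Ec by blast
      have "finprod G (\<lambda>e. e [^] P e) K = finprod G (\<lambda>e. e [^] g e \<otimes> e [^] N e) K"
        using Kc by (intro finprod_cong') (auto simp: g_def subset_iff simp flip: int_pow_mult)
      also have "\<dots> = finprod G (\<lambda>e. e [^] g e) K \<otimes> finprod G (\<lambda>e. e [^] N e) K"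
        using Kc by (intro finprod_multf) auto
      finally have "a \<otimes> c \<otimes> x = finprod G (\<lambda>e. e [^] g e) K \<otimes> (b \<otimes> d \<otimes> y)"
        using finprod_indicators[OF finK(1) Kc, of a c x] finprod_indicators[OF finK(1) Kc, of b d y]
        by (simp add: P_def N_def K_def)
      moreover have "finprod G (\<lambda>e. e [^] g e) K \<in> carrier G"
        using Kc by (intro finprod_closed) auto
      moreover have "b \<otimes> d \<otimes> y \<in> carrier G" using mem Ec by auto
      ultimately show ?thesis using eq by simp
    qed
    have "finprod G (\<lambda>e. e [^] g e) K' = finprod G (\<lambda>e. e [^] g e) K"
    proof (rule finprod_mono_neutral_cong_left)
      show "\<And>i. i \<in> K - K' \<Longrightarrow> i [^] g i = \<one>"
      proof -
        fix i assume "i \<in> K - K'"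
        then have "i \<in> torsion r" "r dvd g i" using KE Et by (auto simp: K'_def)
        then show "i [^] g i = \<one>" by (auto simp: torsion_def dvd_def simp flip: int_pow_pow)
      qed
    qed (use finK KE Ec in \<open>auto simp: K'_def\<close>)
    then have prodK': "finprod G (\<lambda>e. e [^] g e) K' = \<one>" using prodK by simp
    \<comment> \<open>\<open>idx\<close> recovers the stage at which an element of \<open>E\<close>
      was chosen; \<open>t\<close> will be the last element of \<open>K'\<close>.\<close>
    define idx where "idx = inv_into (carrier G) f"
    have idx: "idx s \<in> carrier G" "f (idx s) = s" if "s \<in> E" for s
      using that unfolding idx_def E_def by (simp_all add: inv_into_into f_inv_into_f)
    have K'E: "K' \<subseteq> E" using KE by (auto simp: K'_def)
    have "idx ` K' \<subseteq> carrier G" using K'E idx(1) by blast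
    then have "\<exists>i\<in>idx ` K'. \<forall>j\<in>idx ` K'. j \<noteq> i \<longrightarrow> (j, i) \<in> R"
      using finK \<open>K' \<noteq> {}\<close> tot
      by (intro finite_total_order_has_max trans) (auto simp: K'_def subset_iff)
    then obtain t where t: "t \<in> K'" "\<And>s. s \<in> K' \<Longrightarrow> idx s \<noteq> idx t \<Longrightarrow> (idx s, idx t) \<in> R" by blast
    define S where "S = f ` {y. (y, idx t) \<in> R}"
    have sub: "K' - {t} \<subseteq> S"
    proof
      fix s assume s: "s \<in> K' - {t}"
      then have "idx s \<noteq> idx t" using idx t K'E by (metis DiffD1 DiffD2 insertI1 subsetD)
      then have "(idx s, idx t) \<in> R" using s t by blast
      then show "s \<in> S" using s K'E idx unfolding S_def by (metis DiffD1 imageI mem_Collect_eq subsetD)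
    qed
    have Sc: "S \<subseteq> carrier G" using fc by (auto simp: S_def)
    have tE: "t \<in> E" "t \<in> carrier G" using t K'E Ec by auto
    have good_t: "good S t" using f[of "idx t"] idx[OF tE(1)] by (simp add: S_def)
    \<comment> \<open>\<open>good\<close> forbids positive multiples only. The relation yields
      \<open>t [^] g t = Q (-1)\<close> and \<open>t [^] (- g t) = Q 1\<close>, and one of the two
      exponents is positive.\<close>
    define Q where "Q \<sigma> = finprod G (\<lambda>e. e [^] (\<sigma> * g e)) (K' - {t})" for \<sigma> :: int
    have K't: "K' - {t} \<subseteq> carrier G" using sub Sc by blast
    have fin': "finite (K' - {t})" using finK by (simp add: K'_def)
    have Qw: "Q \<sigma> \<in> words 6 S" if "\<sigma> \<in> {1, -1}" for \<sigma>
    proof -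
      have "\<sigma> * g e \<in> {-3..3}" for e using that bound[of e] by auto
      then have "Q \<sigma> \<in> words (card (K' - {t})) S"
        unfolding Q_def by (intro finprod_mem_words fin' sub Sc)
      moreover have "card (K' - {t}) \<le> 6"
        by (rule order.trans[OF card_mono[OF finK(1)] finK(2)]) (auto simp: K'_def)
      ultimately show ?thesis using words_mono by blast
    qed
    have Qc: "Q \<sigma> \<in> carrier G" for \<sigma> unfolding Q_def using K't by (intro finprod_closed) auto
    have "insert t (K' - {t}) = K'" using t by blast
    moreover have "(\<lambda>e. e [^] g e) \<in> K' - {t} \<rightarrow> carrier G" using K't by auto
    ultimately have t1: "t [^] g t \<otimes> Q 1 = \<one>"
      using prodK' finprod_insert[of "K' - {t}" t "\<lambda>e. e [^] g e"] fin' tE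
      by (simp add: Q_def)
    have QQ: "Q (-1) \<otimes> Q 1 = \<one>"
    proof -
      have "Q (-1) \<otimes> Q 1 = finprod G (\<lambda>e. e [^] (- 1 * g e) \<otimes> e [^] (1 * g e)) (K' - {t})"
        unfolding Q_def using K't by (intro finprod_multf[symmetric]) auto
      also have "\<dots> = finprod G (\<lambda>e. \<one>) (K' - {t})"
        using K't by (intro finprod_cong') (auto simp flip: int_pow_mult)
      finally show ?thesis by simp
    qed
    have tgc: "t [^] g t \<in> carrier G" using tE by simp
    have *: "t [^] g t = Q (-1)"
      using inv_equality[OF t1 Qc tgc] inv_equality[OF QQ Qc Qc] by simp
    have "Q 1 \<otimes> t [^] g t = \<one>" using t1 m_comm[OF tgc Qc] by simp
    then have **: "t [^] (- g t) = Q 1"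
      using inv_equality[OF _ tgc Qc] tE by (simp add: int_pow_neg)
    have ndvd: "\<not> r dvd g t" using t by (simp add: K'_def)
    then have "g t \<noteq> 0" by auto
    show False
    proof (cases "g t > 0")
      case True
      then have "g t \<in> {1, 2, 3}" using bound[of t] by auto
      then show False using good_t * Qw[of "-1"] ndvd unfolding good_def by auto
    next
      case False
      then have "- g t \<in> {1, 2, 3}" using bound[of t] \<open>g t \<noteq> 0\<close> by auto
      moreover have "\<not> r dvd - g t" using ndvd by simp
      ultimately have "t [^] (- g t) \<notin> words 6 S" using good_t unfolding good_def by blast
      then show False using ** Qw[of 1] by simp
    qed
  qed
  moreover have "E \<subseteq> torsion r" using ft by (auto simp: E_def)
  ultimately show ?thesis using r by blast
qed

subsection \<open>Cliques among the quotients of an independent set\<close>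

lemma int_pow_two: "x \<in> carrier G \<Longrightarrow> x [^] (2 :: int) = x \<otimes> x"
  using int_pow_mult[of x 1 1] by simp

lemma independentD:
  assumes "independent r E" "E \<subseteq> carrier G" "i \<in> E" "j \<in> E" "k \<in> E" "l \<in> E" "m \<in> E" "n \<in> E"
    and "(i \<oslash> j) \<oslash> (k \<oslash> l) = m \<oslash> n"
  shows "r dvd of_bool (i = e) + of_bool (l = e) + of_bool (n = e)
     - (of_bool (j = e) + of_bool (k = e) + of_bool (m = e))"
proof -
  have carr: "i \<in> carrier G" "j \<in> carrier G" "k \<in> carrier G" "l \<in> carrier G" "m \<in> carrier G" "n \<in> carrier G"
    using assms by auto
  have "i \<otimes> l \<otimes> n = j \<otimes> k \<otimes> m"
    using assms(9) carr by (simp add: gdiv_simps) (simp add: m_ac)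
  then show ?thesis using assms unfolding independent_def by blast
qed

text \<open>Were \<open>i\<close>, \<open>j\<close>, \<open>k\<close>, \<open>l\<close> distinct,
  each would contribute a coefficient 1 or -1, which \<open>r\<close> does not divide, and only
  \<open>m\<close> and \<open>n\<close> are available to cancel them.\<close>

lemma independent_quotients_meet:
  assumes "independent r E" "E \<subseteq> carrier G" "r \<in> {0, 2, 3}"
    and "i \<in> E" "j \<in> E" "k \<in> E" "l \<in> E" "m \<in> E" "n \<in> E"
    and "(i \<oslash> j) \<oslash> (k \<oslash> l) = m \<oslash> n" "i \<noteq> j" "k \<noteq> l"
  shows "i = k \<or> i = l \<or> j = k \<or> j = l"
proof (rule ccontr)
  assume neg: "\<not> ?thesis"
  note dvd = independentD[OF assms(1,2,4-10)]
  have "i = m \<or> i = n" using dvd[of i] neg assms by (auto simp: of_bool_def split: if_splits)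
  moreover have "j = m \<or> j = n" using dvd[of j] neg assms by (auto simp: of_bool_def split: if_splits)
  moreover have "k = m \<or> k = n" using dvd[of k] neg assms by (auto simp: of_bool_def split: if_splits)
  ultimately show False using neg assms by auto
qed

text \<open>For these \<open>r\<close> orientation matters: an element common to both quotients in
  opposite positions has coefficient 2 or -2 before \<open>m\<close> and \<open>n\<close> are
  counted. For \<open>r = 0\<close> this cannot cancel. For \<open>r = 3\<close> one of
  \<open>m\<close>, \<open>n\<close> has to complete it to 3 or -3, and then the coefficient of the
  other end forces the two quotients to be opposite.\<close>

lemma independent_quotients_oriented:
  assumes "independent r E" "E \<subseteq> carrier G" "r \<in> {0, 3}"
    and "i \<in> E" "j \<in> E" "k \<in> E" "l \<in> E" "m \<in> E" "n \<in> E"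
    and "(i \<oslash> j) \<oslash> (k \<oslash> l) = m \<oslash> n" "i \<noteq> j" "k \<noteq> l"
  shows "i = k \<or> j = l \<or> (i = l \<and> j = k)"
proof (rule ccontr)
  assume neg: "\<not> ?thesis"
  note dvd = independentD[OF assms(1,2,4-10)]
  have "i = k \<or> i = l \<or> j = k \<or> j = l"
    by (rule independent_quotients_meet[OF assms(1,2) _ assms(4-12)]) (use assms(3) in auto)
  then show False using dvd[of i] dvd[of j] neg assms(3,11,12) by (auto simp: of_bool_def split: if_splits)
qed

text \<open>Besides \<one>, a translated clique consists of edges on the vertex set
  \<open>B\<close>, any two of which meet. A star has at most \<open>card B - 1\<close> edges. In
  exponent 2 a triangle with 3 edges is possible too, which \<open>card B \<ge> 4\<close>
  absorbs.\<close>

lemma card_clique_le: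
  assumes E: "E \<subseteq> torsion r" "independent r E" "r \<in> {0, 2, 3}"
    and B: "B \<subseteq> E" "finite B" "card B \<ge> 3" "r = 2 \<Longrightarrow> card B \<ge> 4"
    and C: "clique (quotients B - {\<one>}) C"
  shows "finite C \<and> card C \<le> card B"
proof (rule card_clique_le_translate[OF _ C])
  fix D assume D: "clique (quotients B - {\<one>}) D" "\<one> \<in> D" "D - {\<one>} \<subseteq> quotients B - {\<one>}"
  define D' where "D' = D - {\<one>}"
  have Ec: "E \<subseteq> carrier G" using E by (auto simp: torsion_def)
  have "quotients B = (\<lambda>(a, b). a \<oslash> b) ` (B \<times> B)" by (auto simp: quotients_def)
  then have "finite (quotients B)" using B by simp
  then have finD': "finite D'" using finite_subset[OF D(3)] by (simp add: D'_def)
  then have finD: "finite D" by (simp add: D'_def)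
  have "card D = Suc (card D')"
    using D(2) finD unfolding D'_def by (metis card.remove)
  moreover have "card D' \<le> card B - 1"
  proof (rule ccontr)
    assume "\<not> ?thesis"
    then have big: "card B \<le> card D'" by simp
    have rep: "\<exists>i\<in>B. \<exists>j\<in>B. i \<noteq> j \<and> d = i \<oslash> j" if "d \<in> D'" for d
    proof -
      have "d \<in> quotients B - {\<one>}" using that D(3) by (auto simp: D'_def)
      then obtain a b where "a \<in> B" "b \<in> B" "d = a \<oslash> b" "d \<noteq> \<one>" by (auto simp: quotients_def)
      moreover have "a \<in> carrier G" using \<open>a \<in> B\<close> B Ec by blast
      ultimately have "a \<noteq> b" by auto
      then show ?thesis using \<open>a \<in> B\<close> \<open>b \<in> B\<close> \<open>d = a \<oslash> b\<close> by blast
    qed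
    have diff: "\<exists>m\<in>B. \<exists>n\<in>B. d \<oslash> d' = m \<oslash> n" if "d \<in> D'" "d' \<in> D'" "d \<noteq> d'" for d d'
    proof -
      have "d \<oslash> d' \<in> quotients B" using D(1) that by (auto simp: clique_def D'_def)
      then show ?thesis by (auto simp: quotients_def)
    qed
    have star: False if "i \<in> B" "D' \<subseteq> h ` (B - {i})" for i and h :: "'a \<Rightarrow> 'a"
    proof -
      have "card D' \<le> card (B - {i})"
        by (rule order.trans[OF card_mono[OF _ that(2)] card_image_le]) (simp_all add: B(2))
      then show False using card_Diff_singleton[OF that(1)] big B(3) by linarith
    qed
    show False
    proof (cases "r = 2")
      case False
      then have r: "r \<in> {0, 3}" using E by blast
      have pair: "i = k \<or> j = l \<or> (i = l \<and> j = k)"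
        if ijkl: "i \<in> B" "j \<in> B" "k \<in> B" "l \<in> B" "i \<oslash> j \<in> D'" "k \<oslash> l \<in> D'" "i \<oslash> j \<noteq> k \<oslash> l" "i \<noteq> j" "k \<noteq> l" for i j k l
      proof -
        obtain m n where "m \<in> B" "n \<in> B" "(i \<oslash> j) \<oslash> (k \<oslash> l) = m \<oslash> n"
          using diff[OF ijkl(5-7)] by blast
        then show ?thesis
          using independent_quotients_oriented[OF E(2) Ec r, of i j k l m n] ijkl B by blast
      qed
      \<comment> \<open>Two opposite edges satisfy \<open>pair\<close>, but no third edge is
        compatible with both. So with three edges at hand, \<open>d1\<close> and \<open>d2\<close>
        share their source or their target.\<close>
      obtain T where T: "T \<subseteq> D'" "card T = 3"
        using obtain_subset_with_card_n[of 3 D'] big B(3) by (metis le_trans)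
      then obtain d1 d2 d3 where "T = {d1, d2, d3}" and d': "d1 \<noteq> d2" "d1 \<noteq> d3" "d2 \<noteq> d3"
        by (metis card_3_iff)
      then have d: "d1 \<in> D'" "d2 \<in> D'" "d3 \<in> D'" "d1 \<noteq> d2" "d1 \<noteq> d3" "d2 \<noteq> d3"
        using T(1) by simp_all
      obtain i j where 1: "i \<in> B" "j \<in> B" "i \<noteq> j" "d1 = i \<oslash> j" using rep d by blast
      obtain k l where 2: "k \<in> B" "l \<in> B" "k \<noteq> l" "d2 = k \<oslash> l" using rep d by blast
      obtain p q where 3: "p \<in> B" "q \<in> B" "p \<noteq> q" "d3 = p \<oslash> q" using rep d by blast
      have "\<not> (i = l \<and> j = k)"
        using pair[of i j p q] pair[of k l p q] 1 2 3 d by metis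
      then have "i = k \<or> j = l" using pair[of i j k l] 1 2 d by metis
      then show False
      proof
        assume ik: "i = k"
        have "D' \<subseteq> (\<lambda>q. i \<oslash> q) ` (B - {i})"
        proof
          fix d' assume d': "d' \<in> D'"
          obtain p q where 4: "p \<in> B" "q \<in> B" "p \<noteq> q" "d' = p \<oslash> q" using rep d' by blast
          have "p = i" if "d' \<noteq> d1" "d' \<noteq> d2"
            using pair[of i j p q] pair[of k l p q] 1 2 4 d d' ik that by metis
          then show "d' \<in> (\<lambda>q. i \<oslash> q) ` (B - {i})" using 1 2 4 ik by blast
        qed
        then show False using star 1 by blast
      next
        assume jl: "j = l"
        have "D' \<subseteq> (\<lambda>p. p \<oslash> j) ` (B - {j})"
        proof
          fix d' assume d': "d' \<in> D'"
          obtain p q where 4: "p \<in> B" "q \<in> B" "p \<noteq> q" "d' = p \<oslash> q" using rep d' by blast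
          have "q = j" if "d' \<noteq> d1" "d' \<noteq> d2"
            using pair[of i j p q] pair[of k l p q] 1 2 4 d d' jl that by metis
          then show "d' \<in> (\<lambda>p. p \<oslash> j) ` (B - {j})" using 1 2 4 jl by blast
        qed
        then show False using star 1 by blast
      qed
    next
      case True
      have sym: "i \<oslash> j = j \<oslash> i" if "i \<in> B" "j \<in> B" for i j
      proof -
        have ij: "i \<in> carrier G" "j \<in> carrier G" "i [^] (2 :: int) = \<one>" "j [^] (2 :: int) = \<one>"
          using that B E True by (auto simp: torsion_def)
        then have "i \<otimes> i = j \<otimes> j" using int_pow_two by metis
        then show ?thesis using ij by (simp add: gdiv_simps)
      qed
      have pair: "i = k \<or> i = l \<or> j = k \<or> j = l"
        if ijkl: "i \<in> B" "j \<in> B" "k \<in> B" "l \<in> B" "i \<oslash> j \<in> D'" "k \<oslash> l \<in> D'" "i \<oslash> j \<noteq> k \<oslash> l" "i \<noteq> j" "k \<noteq> l" for i j k l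
      proof -
        obtain m n where "m \<in> B" "n \<in> B" "(i \<oslash> j) \<oslash> (k \<oslash> l) = m \<oslash> n"
          using diff[OF ijkl(5-7)] by blast
        then show ?thesis
          using independent_quotients_meet[OF E(2) Ec E(3), of i j k l m n] ijkl B by blast
      qed
      have "card D' \<ge> 2" using big B by simp
      then obtain d1 d2 where d: "d1 \<in> D'" "d2 \<in> D'" "d1 \<noteq> d2"
        by (meson card_2_iff' obtain_subset_with_card_n subsetD)
      have "\<exists>i j l. i \<in> B \<and> j \<in> B \<and> l \<in> B \<and> i \<noteq> j \<and> i \<noteq> l \<and> d1 = i \<oslash> j \<and> d2 = i \<oslash> l"
      proof -
        obtain i j where 1: "i \<in> B" "j \<in> B" "i \<noteq> j" "d1 = i \<oslash> j" using rep d by blast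
        obtain k l where 2: "k \<in> B" "l \<in> B" "k \<noteq> l" "d2 = k \<oslash> l" using rep d by blast
        have "i = k \<or> i = l \<or> j = k \<or> j = l" using pair[of i j k l] 1 2 d by metis
        then show ?thesis using 1 2 sym by metis
      qed
      then obtain i j l where ijl: "i \<in> B" "j \<in> B" "l \<in> B" "i \<noteq> j" "i \<noteq> l" "d1 = i \<oslash> j" "d2 = i \<oslash> l"
        by blast
      \<comment> \<open>An edge that meets both \<open>i \<oslash> j\<close> and
        \<open>i \<oslash> l\<close> passes through \<open>i\<close> or is the third side
        \<open>j \<oslash> l\<close>. If that side is in \<open>D'\<close>, nothing beyond the
        triangle fits.\<close>
      have star': "d' \<in> {i \<oslash> j, i \<oslash> l, j \<oslash> l} \<or> (j \<oslash> l \<notin> D' \<and> d' \<in> (\<lambda>q. i \<oslash> q) ` (B - {i}))"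
        if d': "d' \<in> D'" for d'
      proof (rule ccontr)
        assume neg: "\<not> ?thesis"
        obtain p q where 4: "p \<in> B" "q \<in> B" "p \<noteq> q" "d' = p \<oslash> q" using rep d' by blast
        have n: "d' \<noteq> d1" "d' \<noteq> d2" "d' \<noteq> j \<oslash> l" using neg ijl by auto
        have "j \<noteq> l" using d ijl by blast
        moreover have "i = p \<or> i = q \<or> j = p \<or> j = q"
          using pair[of i j p q] 4 d' d ijl n by metis
        moreover have "i = p \<or> i = q \<or> l = p \<or> l = q"
          using pair[of i l p q] 4 d' d ijl n by metis
        ultimately have "i = p \<or> i = q" using sym[of p q] n 4 by metis
        then obtain x where x: "x \<in> B" "x \<noteq> i" "d' = i \<oslash> x" using sym[of p q] 4 by metis
        then have "j \<oslash> l \<in> D'" using neg by blast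
        then have "x = j \<or> x = l"
          using pair[of j l i x] x n \<open>j \<noteq> l\<close> ijl d' by metis
        then show False using n ijl x by blast
      qed
      show False
      proof (cases "j \<oslash> l \<in> D'")
        case True
        then have "D' \<subseteq> {i \<oslash> j, i \<oslash> l, j \<oslash> l}" using star' by blast
        then have "card D' \<le> card {i \<oslash> j, i \<oslash> l, j \<oslash> l}" by (simp add: card_mono)
        also have "\<dots> \<le> 3" using card_length[of "[i \<oslash> j, i \<oslash> l, j \<oslash> l]"] by simp
        finally show False using big B \<open>r = 2\<close> by simp
      next
        case False
        then have "D' \<subseteq> (\<lambda>q. i \<oslash> q) ` (B - {i})" using star' ijl by blast
        then show False using star ijl by blast
      qed
    qed
  qed
  ultimately show "finite D \<and> card D \<le> card B" using B(3) finD by simp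
qed

lemma quotients_Diff_one_props:
  assumes "B \<subseteq> carrier G"
  shows "quotients B - {\<one>} \<subseteq> carrier G" "\<one> \<notin> quotients B - {\<one>}"
    "f \<in> quotients B - {\<one>} \<Longrightarrow> inv f \<in> quotients B - {\<one>}" "clique (quotients B - {\<one>}) B"
proof -
  show "quotients B - {\<one>} \<subseteq> carrier G" using assms by (auto simp: quotients_def)
  show "clique (quotients B - {\<one>}) B"
    using assms by (auto simp: clique_def quotients_def gdiv_eq_one_iff subset_iff)
  assume "f \<in> quotients B - {\<one>}"
  then obtain a b where ab: "a \<in> B" "b \<in> B" "f = a \<oslash> b" "f \<noteq> \<one>" by (auto simp: quotients_def)
  then have carr: "a \<in> carrier G" "b \<in> carrier G" using assms by auto
  then have "inv f = b \<oslash> a" using ab by (simp add: gdiv_simps)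
  moreover have "b \<oslash> a \<noteq> \<one>" using ab carr by (auto simp: gdiv_eq_one_iff)
  ultimately show "inv f \<in> quotients B - {\<one>}" using ab by (auto simp: quotients_def)
qed simp

section \<open>Realizing finite and infinite values with independent sets\<close>

lemma exists_sharp_packing_index_independent:
  assumes inf: "infinite (carrier G)"
    and E: "E \<subseteq> torsion r" "independent r E" "r \<in> {0, 2, 3}" "infinite E"
    and n: "n \<ge> 3" "r = 2 \<Longrightarrow> n \<ge> 4"
  shows "\<exists>A\<subseteq>carrier G. sharp_packing_index G A =o natLeq_on (Suc n)"
proof -
  obtain B where B: "B \<subseteq> E" "finite B" "card B = n"
    using infinite_arbitrarily_large[OF E(4)] by blast
  have Bc: "B \<subseteq> carrier G" using B E by (auto simp: torsion_def)
  have "quotients B = (\<lambda>(a, b). a \<oslash> b) ` (B \<times> B)" by (auto simp: quotients_def)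
  then have fin: "finite (quotients B - {\<one>})" using B by simp
  show ?thesis
  proof (rule exists_sharp_packing_index_finite[OF inf quotients_Diff_one_props(1,2)[OF Bc] _ fin])
    show "clique (quotients B - {\<one>}) B" by (rule quotients_Diff_one_props[OF Bc])
    show "finite C \<and> card C \<le> n" if "clique (quotients B - {\<one>}) C" for C
      using card_clique_le[OF E(1-3) B(1,2) _ _ that] B(3) n by simp
  qed (use B quotients_Diff_one_props(3)[OF Bc] in auto)
qed

text \<open>One half of \<open>E\<close> contains disjoint blocks with the sizes of the proper
  initial segments of \<open>|K|\<close>: all below \<open>|K|\<close>, and reaching every smaller
  cardinal. Cliques do not mix blocks. The other half stays free of blocks and shows that
  \<open>F\<close> is sparse.\<close>

lemma exists_sharp_packing_index_infinite:
  fixes K :: "'k set"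
  assumes inf: "infinite (carrier G)" and K: "infinite K" "|K| \<le>o |carrier G|"
  shows "\<exists>A\<subseteq>carrier G. sharp_packing_index G A =o |K|"
proof -
  obtain r E where E: "r \<in> {0, 2, 3}" "E \<subseteq> torsion r" "|E| =o |carrier G|" "independent r E"
    using exists_independent[OF inf] by blast
  have Ec: "E \<subseteq> carrier G" using E by (auto simp: torsion_def)
  have infE: "infinite E" using E(3) inf card_of_ordIso_finite by blast
  have "|E <+> E| =o |E|" using card_of_Plus_infinite1[OF infE card_of_refl[THEN ordIso_imp_ordLeq]] .
  then obtain \<iota> where \<iota>: "inj_on \<iota> (E <+> E)" "\<iota> ` (E <+> E) \<subseteq> E"
    using card_of_ordLeq[of "E <+> E" E] ordIso_imp_ordLeq by blast
  define E1 where "E1 = \<iota> ` Inl ` E"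
  define E2 where "E2 = \<iota> ` Inr ` E"
  have sub: "E1 \<subseteq> E" "E2 \<subseteq> E" using \<iota>(2) unfolding E1_def E2_def by blast+
  have disj: "E1 \<inter> E2 = {}" using \<iota>(1) by (auto simp: E1_def E2_def inj_on_def)
  have "inj_on (\<iota> \<circ> Inl) E" "inj_on (\<iota> \<circ> Inr) E" using \<iota>(1) by (auto simp: inj_on_def)
  then have cardE: "|E| \<le>o |E1|" "|E| \<le>o |E2|"
    unfolding E1_def E2_def image_comp by (auto intro!: card_of_ordLeq[THEN iffD1])
  define k where "k = |K|"
  have k: "Field k = K" "Card_order k" "Well_order k"
    by (simp_all add: k_def Field_card_of card_of_Card_order card_of_Well_order)
  have "|K \<times> K| \<le>o |E1|"
    using card_of_Times_same_infinite[OF K(1)] K(2) ordIso_symmetric[OF E(3)] cardE(1)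
    by (meson ordIso_ordLeq_trans ordLeq_ordIso_trans ordLeq_transitive)
  then obtain \<phi> where \<phi>: "inj_on \<phi> (K \<times> K)" "\<phi> ` (K \<times> K) \<subseteq> E1"
    using card_of_ordLeq[of "K \<times> K" E1] by blast
  \<comment> \<open>Row \<open>g\<close> of the embedded square \<open>K \<times> K\<close>, cut off
    at the initial segment below \<open>g\<close>.\<close>
  define B where "B g = \<phi> ` ({g} \<times> underS k g)" for g
  have under: "underS k g \<subseteq> K" for g using k(1) by (auto simp: underS_def Field_def)
  have BE1: "B g \<subseteq> E1" if "g \<in> K" for g using that \<phi>(2) under[of g] unfolding B_def by blast
  have Bdisj: "g = h" if gh: "g \<in> K" "h \<in> K" "e \<in> B g" "e \<in> B h" for g h e
  proof -
    obtain x where "e = \<phi> (g, x)" "x \<in> underS k g" using gh(3) unfolding B_def by auto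
    moreover obtain y where "e = \<phi> (h, y)" "y \<in> underS k h" using gh(4) unfolding B_def by auto
    ultimately have "(g, x) = (h, y)"
      using under gh by (intro inj_onD[OF \<phi>(1)]) auto
    then show ?thesis by simp
  qed
  have Bless: "|B g| <o |K|" if "g \<in> K" for g
    unfolding B_def using card_of_underS[OF k(2)] that k(1)
    by (intro card_of_image_ordLess card_of_Times_ordLess_infinite K)
      (auto simp: k_def finite_card_of_ordLess_infinite K)
  have Bc: "B g \<subseteq> carrier G" if "g \<in> K" for g using BE1[OF that] sub Ec by blast
  define F where "F = (\<Union>g\<in>K. quotients (B g) - {\<one>})"
  show ?thesis
  proof (rule exists_sharp_packing_index[OF inf card_of_Card_order])
    show "F \<subseteq> carrier G" "\<one> \<notin> F" unfolding F_def using quotients_Diff_one_props(1)[OF Bc] by blast+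
    show "inv f \<in> F" if "f \<in> F" for f
      using that quotients_Diff_one_props(3)[OF Bc] unfolding F_def by blast
  next
    fix S assume S: "S \<subseteq> carrier G" "|S| <o |carrier G|"
    show "\<exists>g\<in>carrier G. g \<notin> S <#> F"
    proof (rule ccontr)
      assume "\<not> ?thesis"
      then have cover: "x \<in> S <#> F" if "x \<in> E2" for x using that sub Ec by blast
      \<comment> \<open>Each \<open>x \<in> E2\<close> picks some \<open>s x \<in> S\<close>. Equal
        picks for distinct \<open>x\<close> and \<open>y\<close> would give a relation between
        \<open>x\<close>, \<open>y\<close> and four elements of \<open>E1\<close> in which
        \<open>x\<close> has coefficient 1. So \<open>S\<close> would be as large as the
        group.\<close>
      have "\<exists>s. s \<in> S \<and> (\<exists>a\<in>E1. \<exists>b\<in>E1. x = s \<otimes> (a \<oslash> b))" if "x \<in> E2" for x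
      proof -
        obtain s f where sf: "s \<in> S" "f \<in> F" "x = s \<otimes> f"
          using cover[OF \<open>x \<in> E2\<close>] unfolding set_mult_def by blast
        then obtain g a b where "g \<in> K" "a \<in> B g" "b \<in> B g" "f = a \<oslash> b"
          unfolding F_def quotients_def by blast
        then show ?thesis using sf BE1 by blast
      qed
      then obtain s where s: "\<And>x. x \<in> E2 \<Longrightarrow> s x \<in> S \<and> (\<exists>a\<in>E1. \<exists>b\<in>E1. x = s x \<otimes> (a \<oslash> b))"
        by metis
      have "inj_on s E2"
      proof (intro inj_onI, rule ccontr)
        fix x y assume xy: "x \<in> E2" "y \<in> E2" "s x = s y" "x \<noteq> y"
        define t where "t = s x"
        have t: "t \<in> carrier G" using s[OF xy(1)] S by (auto simp: t_def)
        obtain a b where ab: "a \<in> E1" "b \<in> E1" "x = t \<otimes> (a \<oslash> b)"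
          using s[OF xy(1)] unfolding t_def by blast
        obtain c d where cd: "c \<in> E1" "d \<in> E1" "y = t \<otimes> (c \<oslash> d)"
          using s[OF xy(2)] unfolding t_def xy(3) by blast
        have E: "x \<in> E" "y \<in> E" "a \<in> E" "b \<in> E" "c \<in> E" "d \<in> E"
          using xy(1,2) ab(1,2) cd(1,2) sub by blast+
        have carr: "a \<in> carrier G" "b \<in> carrier G" "c \<in> carrier G" "d \<in> carrier G"
          using E Ec by blast+
        have "x \<otimes> b \<otimes> c = y \<otimes> d \<otimes> a"
          unfolding ab(3) cd(3) using carr t by (simp add: gdiv_simps) (simp add: m_ac)
        then have "r dvd of_bool (x = x) + of_bool (b = x) + of_bool (c = x)
            - (of_bool (y = x) + of_bool (d = x) + of_bool (a = x))"
          using \<open>independent r E\<close>[unfolded independent_def, rule_format, of x y b d c a] E by blast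
        moreover have "u \<noteq> x" if "u \<in> E1" for u using xy(1) disj that by blast
        ultimately have "r dvd 1" using xy(4) ab(1,2) cd(1,2) by (simp add: eq_commute[of y x])
        then show False using \<open>r \<in> {0, 2, 3}\<close> by auto
      qed
      moreover have "s ` E2 \<subseteq> S" using s by blast
      ultimately have "|E2| \<le>o |S|" using card_of_ordLeq by blast
      then have "|carrier G| \<le>o |S|"
        using ordIso_symmetric[OF E(3)] cardE(2) by (meson ordIso_ordLeq_trans ordLeq_transitive)
      then show False using S(2) not_ordLess_ordLeq by blast
    qed
  next
    fix C assume C: "clique F C"
    show "|C| <o |K|"
    proof (cases "C = {}")
      case True
      then show ?thesis by (simp add: finite_card_of_ordLess_infinite K)
    next
      case False
      then obtain c where c: "c \<in> C" by blast
      define D where "D = (\<lambda>x. x \<oslash> c) ` C"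
      note tr = clique_translate[OF C c, folded D_def]
      \<comment> \<open>Two nontrivial members of \<open>D\<close> share an endpoint, and the blocks
        are disjoint; so a single \<open>d\<close> determines the block of the whole clique.\<close>
      have "\<exists>g\<in>K. D \<subseteq> insert \<one> (quotients (B g))"
      proof (cases "D \<subseteq> {\<one>}")
        case True
        moreover have "K \<noteq> {}" using K by auto
        ultimately show ?thesis by blast
      next
        case False
        then obtain d where d: "d \<in> D" "d \<noteq> \<one>" by blast
        then obtain g where g: "g \<in> K" "d \<in> quotients (B g)" using tr(3) unfolding F_def by blast
        then obtain i j where ij: "i \<in> B g" "j \<in> B g" "d = i \<oslash> j" by (auto simp: quotients_def)
        have "d' \<in> quotients (B g)" if d': "d' \<in> D" "d' \<noteq> \<one>" for d'
        proof (cases "d' = d")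
          case False
          obtain h where h: "h \<in> K" "d' \<in> quotients (B h)" using d' tr(3) unfolding F_def by blast
          then obtain k l where kl: "k \<in> B h" "l \<in> B h" "d' = k \<oslash> l" by (auto simp: quotients_def)
          have "d \<oslash> d' \<in> F" using tr(1) d d' False by (auto simp: clique_def)
          then obtain u m n where mn: "u \<in> K" "m \<in> B u" "n \<in> B u" "d \<oslash> d' = m \<oslash> n"
            by (auto simp: quotients_def F_def)
          have "i \<noteq> j" "k \<noteq> l" using d d' ij kl Bc[OF g(1)] Bc[OF h(1)] by auto
          then have "i = k \<or> i = l \<or> j = k \<or> j = l"
            using independent_quotients_meet[OF E(4) Ec E(1), of i j k l m n] ij kl mn
              BE1[OF g(1)] BE1[OF h(1)] BE1[OF mn(1)] sub by blast
          then have "g = h" using Bdisj[OF g(1) h(1)] ij kl by blast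
          then show ?thesis using h by simp
        qed (use g in simp)
        then show ?thesis using g by blast
      qed
      then obtain g where g: "g \<in> K" "D \<subseteq> insert \<one> (quotients (B g))" by blast
      have "quotients (B g) = (\<lambda>(a, b). a \<oslash> b) ` (B g \<times> B g)" by (auto simp: quotients_def)
      then have "|quotients (B g)| <o |K|"
        using card_of_image_ordLess[OF card_of_Times_ordLess_infinite[OF K(1) Bless[OF g(1)] Bless[OF g(1)]]]
        by simp
      then have "|{\<one>} \<union> quotients (B g)| <o |K|"
        by (intro card_of_Un_ordLess_infinite K) (simp add: finite_card_of_ordLess_infinite K)
      then have "|D| <o |K|" using g(2) by (intro card_of_subset_ordLess[of D]) auto
      moreover have "|C| =o |D|"
        using tr(2) unfolding D_def by (meson bij_betw_imageI card_of_ordIso)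
      ultimately show ?thesis by (rule ordIso_ordLess_trans[rotated])
    qed
  next
    fix \<mu> :: "'a set rel" assume \<mu>: "Card_order \<mu>" "\<mu> <o |K|"
    then have "\<mu> <o k" by (simp add: k_def)
    \<comment> \<open>A smaller cardinal is isomorphic to a proper initial segment of
      \<open>k\<close>, and \<open>B g\<close> is a copy of that segment.\<close>
    then obtain g where g: "g \<in> K" "\<mu> =o Restr k (underS k g)"
      using ordLess_iff_ordIso_Restr[OF k(3) card_order_on_well_order_on[OF \<mu>(1)]] k(1) by blast
    have "|Field \<mu>| =o |Field (Restr k (underS k g))|" by (rule card_of_cong[OF g(2)])
    moreover have "|Field (Restr k (underS k g))| \<le>o |underS k g|"
      by (rule card_of_mono1) (auto simp: Field_def)
    moreover have "|underS k g| \<le>o |B g|"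
    proof (rule card_of_ordLeq[THEN iffD1], intro exI conjI)
      show "inj_on (\<lambda>x. \<phi> (g, x)) (underS k g)"
        using inj_onD[OF \<phi>(1), of "(g, _)" "(g, _)"] under[of g] g(1)
        by (intro inj_onI) (metis SigmaI prod.inject subsetD)
      show "(\<lambda>x. \<phi> (g, x)) ` underS k g \<subseteq> B g" by (auto simp: B_def)
    qed
    ultimately have "|Field \<mu>| \<le>o |B g|" by (meson ordIso_ordLeq_trans ordLeq_transitive)
    then have "\<mu> \<le>o |B g|" using ordIso_ordLeq_iff(1)[OF card_of_Field_ordIso[OF \<mu>(1)]] by blast
    moreover have "clique F (B g)"
      using quotients_Diff_one_props(4)[OF Bc[OF g(1)]] g(1) unfolding clique_def F_def by blast
    ultimately show "\<exists>C. clique F C \<and> \<mu> \<le>o |C|" by blast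
  qed
qed

subsection \<open>The values 2, 3 and 4\<close>

text \<open>For \<open>F = {}\<close> cliques have at most one element.\<close>

lemma exists_sharp_packing_index_2:
  assumes "infinite (carrier G)"
  shows "\<exists>A\<subseteq>carrier G. sharp_packing_index G A =o natLeq_on 2"
proof -
  have "\<exists>A\<subseteq>carrier G. sharp_packing_index G A =o natLeq_on (Suc 1)"
  proof (rule exists_sharp_packing_index_finite[OF assms, of "{}" _ "{\<one>}"])
    fix C assume "clique {} C"
    then have "C \<subseteq> {c}" if "c \<in> C" for c using that by (auto simp: clique_def)
    then have "C = {} \<or> (\<exists>c. C = {c})" by blast
    then show "finite C \<and> card C \<le> 1" by auto
  qed (auto simp: clique_def)
  then show ?thesis by (simp add: numeral_2_eq_2)
qed

text \<open>A three-element clique for \<open>F = {g, inv g}\<close> would be a translate of \<one>,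
  \<open>g\<close>, \<open>inv g\<close> and force \<open>g \<otimes> g\<close> to be
  \<open>g\<close> or \<open>inv g\<close>, which the hypothesis excludes.\<close>

lemma exists_sharp_packing_index_3:
  assumes inf: "infinite (carrier G)" and g: "g \<in> carrier G" "g \<otimes> g \<otimes> g \<noteq> \<one>"
  shows "\<exists>A\<subseteq>carrier G. sharp_packing_index G A =o natLeq_on 3"
proof -
  have g1: "g \<noteq> \<one>" "g \<otimes> g \<noteq> g" "g \<otimes> g \<noteq> inv g"
    using g by (auto simp: gdiv_simps)
  let ?F = "{g, inv g}"
  have nF: "g \<oslash> inv g \<notin> ?F" using g1 g by (simp add: gdiv_def)
  have "\<exists>A\<subseteq>carrier G. sharp_packing_index G A =o natLeq_on (Suc 2)"
  proof (rule exists_sharp_packing_index_finite[OF inf, of ?F _ "{\<one>, g}"])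
    show "clique ?F {\<one>, g}" using g by (auto simp: clique_def gdiv_simps)
    show "finite C \<and> card C \<le> 2" if "clique ?F C" for C
    proof (rule card_clique_le_translate[OF _ that])
      fix D assume D: "clique ?F D" "\<one> \<in> D" "D - {\<one>} \<subseteq> ?F"
      \<comment> \<open>If \<open>g\<close> is its own inverse, \<open>F\<close> has a single
        element and there is nothing to separate.\<close>
      have "g = inv g \<or> \<not> (g \<in> D \<and> inv g \<in> D)" using D(1) nF unfolding clique_def by blast
      then have "D \<subseteq> {\<one>, g} \<or> D \<subseteq> {\<one>, inv g}" using D(3) by blast
      then show "finite D \<and> card D \<le> 2"
        using card_mono[of "{\<one>, g}" D] card_mono[of "{\<one>, inv g}" D] card_length[of "[\<one>, g]"]
          card_length[of "[\<one>, inv g]"] finite_subset[of D "{\<one>, g}"] finite_subset[of D "{\<one>, inv g}"]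
        by auto
    qed
  qed (use g g1 inv_eq_1_iff[OF g(1)] in \<open>auto dest: sym[of \<one>]\<close>)
  then show ?thesis by (simp add: numeral_3_eq_3 numeral_2_eq_2)
qed

text \<open>The six inequalities match the six elements: \<open>x \<oslash> y\<close> equals
  \<open>x\<close>, \<open>y\<close>, \<open>z\<close>, \<open>inv x\<close>, \<open>inv y\<close>,
  \<open>inv z\<close> iff \<open>y = \<one>\<close>, \<open>y \<otimes> y = x\<close>,
  \<open>x \<otimes> x = \<one>\<close>, \<open>x \<otimes> x = y\<close>,
  \<open>x = \<one>\<close>, \<open>y \<otimes> y = \<one>\<close>, respectively.\<close>

lemma gdiv_notin_hexagon:
  assumes carr: "x \<in> carrier G" "y \<in> carrier G" "z \<in> carrier G" and sum: "x \<otimes> y \<otimes> z = \<one>"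
    and "x \<noteq> \<one>" "y \<noteq> \<one>" "x \<otimes> x \<noteq> \<one>" "y \<otimes> y \<noteq> \<one>" "x \<otimes> x \<noteq> y" "y \<otimes> y \<noteq> x"
  shows "x \<oslash> y \<notin> {x, y, z, inv x, inv y, inv z}"
proof -
  have z: "z = inv (x \<otimes> y)" using sum carr by (metis inv_equality inv_inv m_closed m_comm)
  have "x \<oslash> y \<noteq> x" "x \<oslash> y \<noteq> y" "x \<oslash> y \<noteq> inv x" "x \<oslash> y \<noteq> inv y"
    using assms by (auto simp: gdiv_simps)
  moreover have "x \<oslash> y \<noteq> z"
  proof
    assume "x \<oslash> y = z"
    then have "(x \<otimes> x) \<otimes> y = y" using carr unfolding z by (simp add: gdiv_simps m_ac)
    then show False using assms carr by simp
  qed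
  moreover have "x \<oslash> y \<noteq> inv z"
  proof
    assume "x \<oslash> y = inv z"
    then have "x = x \<otimes> (y \<otimes> y)" using carr unfolding z by (simp add: gdiv_simps m_ac)
    then show False using assms carr by simp
  qed
  ultimately show ?thesis by blast
qed

text \<open>The hexagon consists of \<open>u\<close>, \<open>v\<close>,
  \<open>w = inv (u \<otimes> v)\<close> and their inverses. The squares of \<open>u\<close> and
  \<open>v\<close> are fixed first; squaring has infinite fibres, so the roots can avoid the
  finitely many coincidences that \<open>gdiv_notin_hexagon\<close> rules out.\<close>

lemma exists_sharp_packing_index_4_squares:
  assumes inf: "infinite (carrier G)" "infinite (torsion 2)"
    and sq: "\<And>c. c \<in> carrier G \<Longrightarrow> \<exists>x\<in>carrier G. x \<otimes> x \<noteq> \<one> \<and> x \<otimes> x \<noteq> c"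
  shows "\<exists>A\<subseteq>carrier G. sharp_packing_index G A =o natLeq_on 4"
proof -
  obtain s where s: "s \<in> carrier G" "s \<otimes> s \<noteq> \<one>" using sq[of \<one>] by auto
  define \<alpha> where "\<alpha> = s \<otimes> s"
  have \<alpha>: "\<alpha> \<in> carrier G" "\<alpha> \<noteq> \<one>" using s by (auto simp: \<alpha>_def)
  \<comment> \<open>Taking \<open>c = inv \<alpha>\<close> makes
    \<open>\<alpha> \<otimes> \<beta> \<noteq> \<one>\<close>, and hence
    \<open>w \<otimes> w \<noteq> \<one>\<close>.\<close>
  obtain t where t: "t \<in> carrier G" "t \<otimes> t \<noteq> \<one>" "t \<otimes> t \<noteq> inv \<alpha>" using sq[of "inv \<alpha>"] \<alpha> by auto
  define \<beta> where "\<beta> = t \<otimes> t"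
  have \<beta>: "\<beta> \<in> carrier G" "\<beta> \<noteq> \<one>" "\<beta> \<noteq> inv \<alpha>" using t by (auto simp: \<beta>_def)
  have fibre: "infinite {x \<in> carrier G. x \<otimes> x = a \<otimes> a}" if a: "a \<in> carrier G" for a
  proof
    assume "finite {x \<in> carrier G. x \<otimes> x = a \<otimes> a}"
    moreover have "(\<lambda>x. a \<otimes> x) ` torsion 2 \<subseteq> {x \<in> carrier G. x \<otimes> x = a \<otimes> a}"
    proof (rule image_subsetI)
      fix x assume "x \<in> torsion 2"
      then have x: "x \<in> carrier G" "x \<otimes> x = \<one>" by (auto simp: torsion_def int_pow_two)
      have "(a \<otimes> x) \<otimes> (a \<otimes> x) = (a \<otimes> a) \<otimes> (x \<otimes> x)" using x(1) a by (simp add: m_ac)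
      then show "a \<otimes> x \<in> {x \<in> carrier G. x \<otimes> x = a \<otimes> a}" using x a by simp
    qed
    moreover have "inj_on (\<lambda>x. a \<otimes> x) (torsion 2)"
      using a by (intro inj_onI) (auto simp: torsion_def)
    ultimately show False using inf(2) by (meson finite_imageD finite_subset)
  qed
  \<comment> \<open>The excluded values are the squares of the later \<open>v\<close> and
    \<open>w\<close>.\<close>
  obtain u where u: "u \<in> carrier G" "u \<otimes> u = \<alpha>" "u \<notin> {\<beta>, inv (\<alpha> \<otimes> \<beta>)}"
  proof -
    have "\<not> {x \<in> carrier G. x \<otimes> x = s \<otimes> s} \<subseteq> {\<beta>, inv (\<alpha> \<otimes> \<beta>)}"
      using fibre[OF s(1)] finite_subset by blast
    then show ?thesis using that unfolding \<alpha>_def by blast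
  qed
  \<comment> \<open>The first two excluded values are the squares of \<open>u\<close> and
    \<open>w\<close>. The last two would make \<open>w\<close> the square of \<open>u\<close> or of
    \<open>v\<close>, by \<open>v = inv (u \<otimes> w)\<close>.\<close>
  obtain v where v: "v \<in> carrier G" "v \<otimes> v = \<beta>" "v \<notin> {\<alpha>, inv (\<alpha> \<otimes> \<beta>), inv (u \<otimes> \<alpha>), inv (u \<otimes> \<beta>)}"
  proof -
    have "\<not> {x \<in> carrier G. x \<otimes> x = t \<otimes> t} \<subseteq> {\<alpha>, inv (\<alpha> \<otimes> \<beta>), inv (u \<otimes> \<alpha>), inv (u \<otimes> \<beta>)}"
      using fibre[OF t(1)] finite_subset by blast
    then show ?thesis using that unfolding \<beta>_def by blast
  qed
  define w where "w = inv (u \<otimes> v)"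
  have w: "w \<in> carrier G" using u v by (simp add: w_def)
  have ww: "w \<otimes> w = inv (\<alpha> \<otimes> \<beta>)"
    unfolding w_def u(2)[symmetric] v(2)[symmetric] using u(1) v(1) by (simp add: inv_mult m_ac)
  have uvw: "u \<otimes> v \<otimes> w = \<one>" using u v by (simp add: w_def)
  have \<alpha>\<beta>: "\<alpha> \<otimes> \<beta> \<noteq> \<one>"
    using \<alpha> \<beta> by (metis inv_equality inv_inv m_comm)
  have ww1: "w \<otimes> w \<noteq> \<one>"
    unfolding ww using \<alpha>\<beta> \<alpha> \<beta> by (metis inv_eq_1_iff m_closed)
  have one: "u \<noteq> \<one>" "v \<noteq> \<one>" "w \<noteq> \<one>" using u v \<alpha> \<beta> ww1 by auto
  have sqs: "u \<otimes> u \<noteq> \<one>" "v \<otimes> v \<noteq> \<one>" "u \<otimes> u \<noteq> v" "v \<otimes> v \<noteq> u" "w \<otimes> w \<noteq> u" "w \<otimes> w \<noteq> v"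
    using u v \<alpha> \<beta> unfolding ww by auto
  have solve: "v = inv (u \<otimes> a)" if "a = w" "a \<in> carrier G" for a
  proof -
    have "v \<otimes> (u \<otimes> a) = \<one>" using uvw that u v by (simp add: m_ac)
    then show ?thesis using inv_equality[of v "u \<otimes> a"] that u v by simp
  qed
  have sqw: "u \<otimes> u \<noteq> w" "v \<otimes> v \<noteq> w"
    using solve[of \<alpha>] solve[of \<beta>] u v \<alpha> \<beta> by auto
  define U where "U = {u, v, w}"
  define F where "F = {u, v, w, inv u, inv v, inv w}"
  have Uc: "U \<subseteq> carrier G" using u v w by (simp add: U_def)
  have perm: "v \<otimes> u \<otimes> w = \<one>" "u \<otimes> w \<otimes> v = \<one>" "w \<otimes> u \<otimes> v = \<one>" "v \<otimes> w \<otimes> u = \<one>" "w \<otimes> v \<otimes> u = \<one>"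
    using uvw u v w by (simp_all add: m_ac)
  have UF: "x \<oslash> y \<notin> F" if "x \<in> U" "y \<in> U" "x \<noteq> y" for x y
  proof -
    note hex = gdiv_notin_hexagon
    have "u \<oslash> v \<notin> F" using hex[OF u(1) v(1) w uvw] one sqs sqw ww1 unfolding F_def by blast
    moreover have "v \<oslash> u \<notin> F" using hex[OF v(1) u(1) w perm(1)] one sqs sqw ww1 unfolding F_def by blast
    moreover have "u \<oslash> w \<notin> F" using hex[OF u(1) w v(1) perm(2)] one sqs sqw ww1 unfolding F_def by blast
    moreover have "w \<oslash> u \<notin> F" using hex[OF w u(1) v(1) perm(3)] one sqs sqw ww1 unfolding F_def by blast
    moreover have "v \<oslash> w \<notin> F" using hex[OF v(1) w u(1) perm(4)] one sqs sqw ww1 unfolding F_def by blast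
    moreover have "w \<oslash> v \<notin> F" using hex[OF w v(1) u(1) perm(5)] one sqs sqw ww1 unfolding F_def by blast
    ultimately show ?thesis using that unfolding U_def by blast
  qed
  have le1: "finite X \<and> card X \<le> 1" if "\<And>x y. x \<in> X \<Longrightarrow> y \<in> X \<Longrightarrow> x = y" for X :: "'a set"
  proof -
    have "X = {} \<or> (\<exists>x. X = {x})" using that by blast
    then show ?thesis by auto
  qed
  have "\<exists>A\<subseteq>carrier G. sharp_packing_index G A =o natLeq_on (Suc 3)"
  \<comment> \<open>The witness has one element of each orientation, with
    \<open>u \<oslash> inv v = u \<otimes> v = inv w\<close>.\<close>
  proof (rule exists_sharp_packing_index_finite[OF inf(1), of F _ "{\<one>, u, inv v}"])
    show "F \<subseteq> carrier G" "\<one> \<notin> F" "finite F"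
      using u v w one by (auto simp: F_def dest: sym[of \<one>])
    show "inv f \<in> F" if "f \<in> F" for f using that u v w by (auto simp: F_def)
    have wuv: "u \<otimes> v = inv w" using u v by (simp add: w_def)
    have "u \<noteq> inv v" using wuv one w u v by (metis inv_eq_1_iff l_inv)
    moreover have "\<one> \<noteq> inv v" using one v inv_eq_1_iff by metis
    ultimately show "card {\<one>, u, inv v} = 3" using one(1) by simp
    have "u \<oslash> inv v = inv w" "inv v \<oslash> u = w"
      using u(1) v(1) unfolding w_def by (simp_all add: gdiv_simps m_ac)
    then show "clique F {\<one>, u, inv v}"
      using u(1) v(1) by (auto simp: clique_def F_def) (simp_all add: gdiv_def)
    show "finite C \<and> card C \<le> 3" if "clique F C" for C
    proof (rule card_clique_le_translate[OF _ that])
      fix D assume D: "clique F D" "\<one> \<in> D" "D - {\<one>} \<subseteq> F"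
      \<comment> \<open>By \<open>UF\<close> a clique contains at most one of \<open>u\<close>,
        \<open>v\<close>, \<open>w\<close> and, after inversion, at most one of their
        inverses.\<close>
      let ?P = "D \<inter> U" and ?N = "D \<inter> m_inv G ` U"
      have P: "finite ?P \<and> card ?P \<le> 1"
        using D(1) UF unfolding clique_def by (intro le1) blast
      have N: "finite ?N \<and> card ?N \<le> 1"
      proof (rule le1, rule ccontr)
        fix a b assume ab: "a \<in> ?N" "b \<in> ?N" "a \<noteq> b"
        then obtain x y where xy: "x \<in> U" "y \<in> U" "a = inv x" "b = inv y" by blast
        then have "x \<in> carrier G" "y \<in> carrier G" using Uc by auto
        then have "a \<oslash> b = y \<oslash> x" using xy by (simp add: gdiv_def m_comm)
        moreover have "a \<oslash> b \<in> F" using D(1) ab by (simp add: clique_def)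
        ultimately show False using UF[of y x] xy ab by auto
      qed
      have sub: "D \<subseteq> {\<one>} \<union> (?P \<union> ?N)" using D(3) by (auto simp: F_def U_def)
      have fin: "finite ({\<one>} \<union> (?P \<union> ?N))" using P N by simp
      have "finite D" "card D \<le> card ({\<one>} \<union> (?P \<union> ?N))"
        by (rule finite_subset[OF sub fin], rule card_mono[OF fin sub])
      moreover have "card ({\<one>} \<union> (?P \<union> ?N)) \<le> 1 + (card ?P + card ?N)"
        using card_Un_le[of "{\<one>}" "?P \<union> ?N"] card_Un_le[of ?P ?N] by simp
      ultimately show "finite D \<and> card D \<le> 3" using P N by simp
    qed
  qed simp
  then show ?thesis by (simp add: numeral_eq_Suc)
qed

section \<open>Cliques that always extend: exponent 3, and groups with few squares\<close>

lemma clique_insert: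
  assumes "clique F C" "w \<in> carrier G" "\<And>b. b \<in> C \<Longrightarrow> w \<oslash> b \<in> F" "\<And>b. b \<in> C \<Longrightarrow> b \<oslash> w \<in> F"
  shows "clique F (insert w C)"
  using assms by (auto simp: clique_def)

text \<open>With \<open>x = b \<oslash> a\<close>, the points \<open>a\<close>,
  \<open>a \<otimes> x\<close> and \<open>a \<otimes> x \<otimes> x\<close> have only
  \<open>x\<close> and \<open>inv x\<close> as nontrivial quotients, because
  \<open>x \<otimes> x = inv x\<close>.\<close>

lemma exponent_3_clique:
  assumes exp: "\<And>x. x \<in> carrier G \<Longrightarrow> x \<otimes> x \<otimes> x = \<one>" and C: "clique F C" "card C = 2"
  shows "\<exists>D. clique F D \<and> finite D \<and> card D = 3"
proof -
  obtain a b where ab: "C = {a, b}" "a \<noteq> b" using C(2) by (auto simp: card_2_iff)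
  have carr: "a \<in> carrier G" "b \<in> carrier G" using C ab by (auto simp: clique_def)
  define x where "x = b \<oslash> a"
  define w where "w = b \<otimes> x"
  have x: "x \<in> carrier G" "x \<noteq> \<one>" using carr ab by (auto simp: x_def gdiv_eq_one_iff)
  have F: "a \<oslash> b \<in> F" "x \<in> F" using C ab by (auto simp: clique_def x_def)
  have invx: "inv x = a \<oslash> b" using carr by (simp add: x_def gdiv_simps)
  have x2: "x \<otimes> x = inv x" using exp[OF x(1)] x(1) inv_equality[of "x \<otimes> x" x] by simp
  have b: "b = a \<otimes> x" using carr by (simp add: x_def gdiv_simps m_comm)
  have "w \<oslash> b = x" "b \<oslash> w = inv x" using carr x by (simp_all add: w_def gdiv_simps m_ac)
  moreover have "w \<oslash> a = x \<otimes> x" "a \<oslash> w = inv (x \<otimes> x)"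
    using carr x unfolding w_def b by (simp_all add: gdiv_simps m_ac)
  ultimately have d: "w \<oslash> b \<in> F" "b \<oslash> w \<in> F" "w \<oslash> a \<in> F" "a \<oslash> w \<in> F" "w \<oslash> a \<noteq> \<one>" "w \<oslash> b \<noteq> \<one>"
    using F x x2 invx inv_inv[OF x(1)] by auto
  have wc: "w \<in> carrier G" using carr x by (simp add: w_def)
  have "clique F (insert w C)" using C(1) wc d ab by (intro clique_insert) auto
  moreover have "w \<notin> C" using d wc ab by auto
  ultimately show ?thesis using C(2) ab by (intro exI[of _ "insert w C"]) auto
qed

text \<open>Two of three elements have equal squares. If these are \<open>x\<close> and
  \<open>y\<close>, the quotients of \<open>w = y \<otimes> z \<oslash> x\<close> with
  \<open>x\<close>, \<open>y\<close>, \<open>z\<close> already occur among \<open>x\<close>,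
  \<open>y\<close>, \<open>z\<close>.\<close>

lemma equal_squares_clique:
  assumes sq: "\<And>x. x \<in> carrier G \<Longrightarrow> x \<otimes> x = \<one> \<or> x \<otimes> x = c" and C: "clique F C" "card C = 3"
  shows "\<exists>D. clique F D \<and> finite D \<and> card D = 4"
proof -
  obtain a b d where abd: "C = {a, b, d}" "a \<noteq> b" "b \<noteq> d" "a \<noteq> d" using C(2) by (auto simp: card_3_iff)
  have Cc: "C \<subseteq> carrier G" using C by (simp add: clique_def)
  have "a \<otimes> a = b \<otimes> b \<or> a \<otimes> a = d \<otimes> d \<or> b \<otimes> b = d \<otimes> d"
    using sq[of a] sq[of b] sq[of d] Cc abd by auto
  then obtain x y z where xyz: "C = {x, y, z}" "x \<noteq> y" "y \<noteq> z" "x \<noteq> z" "x \<otimes> x = y \<otimes> y"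
    using abd by (metis insert_commute)
  have carr: "x \<in> carrier G" "y \<in> carrier G" "z \<in> carrier G" using Cc xyz by auto
  define w where "w = y \<otimes> z \<oslash> x"
  have wc: "w \<in> carrier G" using carr by (simp add: w_def)
  have F: "p \<oslash> q \<in> F" if "p \<in> {x, y, z}" "q \<in> {x, y, z}" "p \<noteq> q" for p q
    using C(1) that unfolding xyz(1) clique_def by blast
  have "w \<oslash> y = z \<oslash> x" "y \<oslash> w = x \<oslash> z" "w \<oslash> z = y \<oslash> x" "z \<oslash> w = x \<oslash> y"
    using carr by (simp_all add: w_def gdiv_simps m_ac)
  moreover have "w \<oslash> x = z \<oslash> y"
    using carr xyz(5) by (simp add: w_def gdiv_simps) (simp add: m_ac)
  moreover have "x \<oslash> w = y \<oslash> z"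
    using carr xyz(5) by (simp add: w_def gdiv_simps) (simp add: m_ac)
  moreover have "z \<oslash> x \<noteq> \<one>" "y \<oslash> x \<noteq> \<one>" "z \<oslash> y \<noteq> \<one>"
    using carr xyz by (auto simp: gdiv_eq_one_iff)
  ultimately have d: "w \<oslash> b \<in> F" "b \<oslash> w \<in> F" "w \<oslash> b \<noteq> \<one>" if "b \<in> C" for b
    using that xyz F by auto
  have "clique F (insert w C)" using C(1) wc d by (intro clique_insert) auto
  moreover have "w \<notin> C" using d wc by force
  moreover have "finite C" using xyz by simp
  ultimately show ?thesis using C(2) by (intro exI[of _ "insert w C"]) auto
qed

subsection \<open>Groups of bounded exponent as direct sums\<close>

lemma finprod_mem_subgroup:
  assumes "subgroup S G" "\<And>i. i \<in> K \<Longrightarrow> f i \<in> S"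
  shows "finprod G f K \<in> S"
proof (cases "finite K")
  case True
  then show ?thesis using assms(2)
  proof (induction K)
    case empty
    then show ?case using subgroup.one_closed[OF assms(1)] by simp
  next
    case (insert i K)
    have "f \<in> insert i K \<rightarrow> carrier G" using insert.prems subgroup.mem_carrier[OF assms(1)] by blast
    then show ?case using insert subgroup.m_closed[OF assms(1)] by simp
  qed
qed (simp add: finprod_infinite subgroup.one_closed[OF assms(1)])

lemma int_pow_mod_torsion:
  assumes "i \<in> torsion p"
  shows "i [^] (k mod p) = i [^] k"
proof -
  have i: "i \<in> carrier G" "i [^] p = \<one>" using assms by (auto simp: torsion_def)
  have "i [^] k = i [^] (p * (k div p) + k mod p)" by simp
  also have "\<dots> = i [^] (k mod p)" using i by (simp only: int_pow_mult int_pow_pow[symmetric]) simp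
  finally show ?thesis by simp
qed

lemma int_pow_hom_integer_mod_group:
  assumes "i \<in> torsion (int p)"
  shows "(\<lambda>k. i [^] k) \<in> hom (integer_mod_group p) G"
proof (rule homI)
  show "i [^] k \<in> carrier G" for k :: int using assms by (simp add: torsion_def)
  show "i [^] (k \<otimes>\<^bsub>integer_mod_group p\<^esub> l) = i [^] k \<otimes> i [^] l" for k l :: int
    using int_pow_mod_torsion[OF assms] assms by (simp add: torsion_def int_pow_mult)
qed

text \<open>
  The basis \<open>I\<close> consists of the elements that are not generated by \<open>C\<close> and their predecessors in a
  well-order; so a relation is refuted at its last element, and no appeal to maximality is needed.
\<close>

lemma exists_sum_group_complement:
  assumes inf: "infinite (carrier G)" and C: "subgroup C G" and p: "prime p"
  shows "\<exists>(I :: 'a set) \<Phi>. \<Phi> \<in> hom (sum_group I (\<lambda>_. integer_mod_group p)) G \<and>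
    (\<forall>x\<in>carrier (sum_group I (\<lambda>_. integer_mod_group p)). \<Phi> x \<in> C \<longrightarrow>
      x = \<one>\<^bsub>sum_group I (\<lambda>_. integer_mod_group p)\<^esub>) \<and>
    torsion (int p) \<subseteq> C <#> \<Phi> ` carrier (sum_group I (\<lambda>_. integer_mod_group p))"
proof -
  let ?T = "torsion (int p)"
  obtain R where wf: "wf R" and trans: "trans R"
    and tot: "\<And>x y. x \<in> carrier G \<Longrightarrow> y \<in> carrier G \<Longrightarrow> x \<noteq> y \<Longrightarrow> (x, y) \<in> R \<or> (y, x) \<in> R"
    using exists_initial_well_order[OF inf] by metis
  define below where "below x = C \<union> {y \<in> ?T. (y, x) \<in> R}" for x
  define I where "I = {x \<in> ?T. x \<notin> generate G (below x)}"
  define S where "S = sum_group I (\<lambda>_. integer_mod_group p)"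
  \<comment> \<open>\<open>I\<close> may be infinite; \<open>gfinprod\<close> multiplies over the
    finite support.\<close>
  define \<Phi> where "\<Phi> x = gfinprod G (\<lambda>i. i [^] x i) I" for x :: "'a \<Rightarrow> int"
  have Tc: "?T \<subseteq> carrier G" by (auto simp: torsion_def)
  have belowc: "below x \<subseteq> carrier G" for x using Tc subgroup.subset[OF C] by (auto simp: below_def)
  have gen: "subgroup (generate G (below x)) G" for x by (rule generate_is_subgroup[OF belowc])
  have IT: "I \<subseteq> ?T" by (auto simp: I_def)
  have p0: "p > 0" using p prime_gt_0_nat by blast
  have hom: "\<Phi> \<in> hom S G"
    unfolding \<Phi>_def S_def
    using IT int_pow_hom_integer_mod_group by (intro hom_group_sum) auto
  have grpS: "group S" unfolding S_def by simp
  interpret \<Phi>: group_hom S G \<Phi>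
    using hom grpS by (simp add: group_hom_def group_hom_axioms_def is_group)
  have carrS: "x \<in> carrier S \<longleftrightarrow> x \<in> (\<Pi>\<^sub>E i\<in>I. {0..<int p}) \<and> finite {i \<in> I. x i \<noteq> 0}" for x
    using p0 by (simp add: S_def carrier_sum_group carrier_integer_mod_group)
  have "x = \<one>\<^bsub>S\<^esub>" if x: "x \<in> carrier S" "\<Phi> x \<in> C" for x
  proof (rule ccontr)
    assume neq: "x \<noteq> \<one>\<^bsub>S\<^esub>"
    define K where "K = {i \<in> I. x i \<noteq> 0}"
    have K: "finite K" "K \<subseteq> I" using x by (auto simp: carrS K_def)
    have "K \<noteq> {}"
    proof
      assume "K = {}"
      then have "x = (\<lambda>i\<in>I. 0)" using x(1) by (auto simp: carrS K_def PiE_iff extensional_def fun_eq_iff)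
      then show False using neq by (simp add: S_def)
    qed
    moreover have "(a, b) \<in> R \<or> (b, a) \<in> R" if "a \<in> K" "b \<in> K" "a \<noteq> b" for a b
      using that K IT Tc by (intro tot) auto
    ultimately obtain t where t: "t \<in> K" "\<And>s. s \<in> K \<Longrightarrow> s \<noteq> t \<Longrightarrow> (s, t) \<in> R"
      using finite_total_order_has_max[OF K(1) _ trans] by blast
    let ?B = "generate G (below t)"
    have tT: "t \<in> ?T" "t \<in> carrier G" using t K IT Tc by auto
    have xc: "i [^] x i \<in> carrier G" if "i \<in> K" for i using that K IT Tc by auto
    have "\<Phi> x = gfinprod G (\<lambda>i. i [^] x i) K"
      unfolding \<Phi>_def using IT Tc by (intro gfinprod_mono_neutral_cong_right) (auto simp: K_def)
    also have "\<dots> = finprod G (\<lambda>i. i [^] x i) K" using K xc by simp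
    also have "\<dots> = finprod G (\<lambda>i. i [^] x i) (insert t (K - {t}))" using t by (simp add: insert_absorb)
    also have "\<dots> = t [^] x t \<otimes> finprod G (\<lambda>i. i [^] x i) (K - {t})"
      using K xc t by (intro finprod_insert) auto
    finally have eq: "\<Phi> x = t [^] x t \<otimes> finprod G (\<lambda>i. i [^] x i) (K - {t})" (is "_ = _ \<otimes> ?P") .
    have P: "?P \<in> ?B"
    proof (rule finprod_mem_subgroup[OF gen])
      fix i assume "i \<in> K - {t}"
      then have "i \<in> below t" using t K IT by (auto simp: below_def)
      then have "i \<in> ?B" by (rule generate.incl)
      then show "i [^] x i \<in> ?B" by (rule subgroup_int_pow_closed[OF gen])
    qed
    have "\<Phi> x \<in> ?B" using x(2) by (intro generate.incl) (simp add: below_def)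
    moreover have Pc: "?P \<in> carrier G" using P subgroup.mem_carrier[OF gen] by blast
    have "t [^] x t = \<Phi> x \<otimes> inv ?P"
      unfolding eq using Pc tT by (simp add: m_assoc)
    ultimately have tx: "t [^] x t \<in> ?B"
      using P subgroup.m_closed[OF gen] subgroup.m_inv_closed[OF gen] by simp
    \<comment> \<open>A coefficient strictly between 0 and the prime \<open>p\<close> is invertible
      modulo \<open>p\<close>, so \<open>t\<close> itself lies in \<open>?B\<close>.\<close>
    have "0 < x t" "x t < int p" using x(1) t K by (auto simp: carrS K_def PiE_iff)
    then have "coprime (int p) (x t)"
      using p zdvd_not_zless[of "x t" "int p"] by (intro prime_imp_coprime) auto
    then obtain u v where uv: "u * int p + v * x t = 1"
      by (metis bezout_int coprime_iff_gcd_eq_1)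
    have "t = t [^] (int p * u + x t * v)" using uv tT by (simp add: mult.commute)
    also have "\<dots> = (t [^] int p) [^] u \<otimes> (t [^] x t) [^] v"
      using tT by (simp add: int_pow_mult int_pow_pow)
    also have "\<dots> = (t [^] x t) [^] v" using tT by (simp add: torsion_def)
    also have "\<dots> \<in> ?B" by (rule subgroup_int_pow_closed[OF gen tx])
    finally show False using t K by (auto simp: I_def)
  qed
  moreover have "?T \<subseteq> C <#> \<Phi> ` carrier S"
  proof
    have sub: "subgroup (C <#> \<Phi> ` carrier S) G"
      by (rule mult_subgroups[OF C \<Phi>.img_is_subgroup])
    have one: "\<one> \<in> C" "\<one> \<in> \<Phi> ` carrier S"
      using subgroup.one_closed[OF C] subgroup.one_closed[OF \<Phi>.img_is_subgroup] by auto
    fix x assume "x \<in> ?T"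
    then show "x \<in> C <#> \<Phi> ` carrier S"
    \<comment> \<open>A basis element is the image of the unit vector \<open>\<delta>\<close>; any
      other is generated by \<open>C\<close> and earlier elements, which the induction
      covers.\<close>
    proof (induction x rule: wf_induct_rule[OF wf])
      case (1 x)
      have xc: "x \<in> carrier G" using 1 Tc by blast
      show ?case
      proof (cases "x \<in> I")
        case True
        define \<delta> where "\<delta> = (\<lambda>i\<in>I. if i = x then 1 else 0 :: int)"
        have "{i \<in> I. \<delta> i \<noteq> 0} \<subseteq> {x}" by (auto simp: \<delta>_def)
        then have "\<delta> \<in> carrier S"
          using prime_gt_1_nat[OF p] finite_subset by (auto simp: carrS \<delta>_def)
        moreover have "\<Phi> \<delta> = gfinprod G (\<lambda>i. i [^] \<delta> i) {x}"
          unfolding \<Phi>_def using True IT Tc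
          by (intro gfinprod_mono_neutral_cong_right) (auto simp: \<delta>_def)
        moreover have "\<dots> = x" using True xc by (simp add: \<delta>_def)
        ultimately have "x \<in> \<Phi> ` carrier S" by (metis imageI)
        then show ?thesis using one xc unfolding set_mult_def by force
      next
        case False
        have "C \<subseteq> C <#> \<Phi> ` carrier S"
          using one subgroup.subset[OF C] unfolding set_mult_def by force
        then have "below x \<subseteq> C <#> \<Phi> ` carrier S" using 1 by (auto simp: below_def)
        then have "generate G (below x) \<subseteq> C <#> \<Phi> ` carrier S" by (rule generate_subgroup_incl[OF _ sub])
        then show ?thesis using False 1 by (auto simp: I_def)
      qed
    qed
  qed
  ultimately show ?thesis using hom unfolding S_def by blast
qed

text \<open>A vector space over the field with \<open>p\<close> elements has a basis: a complement
  of the trivial subgroup is everything.\<close>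

lemma iso_sum_group_prime:
  assumes inf: "infinite (carrier G)" and p: "prime p" and exp: "carrier G \<subseteq> torsion (int p)"
  shows "\<exists>I :: 'a set. G \<cong> sum_group I (\<lambda>_. integer_mod_group p)"
proof -
  obtain I :: "'a set" and \<Phi> where \<Phi>: "\<Phi> \<in> hom (sum_group I (\<lambda>_. integer_mod_group p)) G"
    "\<And>x. x \<in> carrier (sum_group I (\<lambda>_. integer_mod_group p)) \<Longrightarrow> \<Phi> x \<in> {\<one>} \<Longrightarrow>
      x = \<one>\<^bsub>sum_group I (\<lambda>_. integer_mod_group p)\<^esub>"
    "torsion (int p) \<subseteq> {\<one>} <#> \<Phi> ` carrier (sum_group I (\<lambda>_. integer_mod_group p))"
    using exists_sum_group_complement[OF inf triv_subgroup p] by metis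
  let ?S = "sum_group I (\<lambda>_. integer_mod_group p)"
  have grp: "group ?S" by simp
  interpret \<Phi>: group_hom ?S G \<Phi>
    using \<Phi>(1) grp by (simp add: group_hom_def group_hom_axioms_def is_group)
  have "inj_on \<Phi> (carrier ?S)" unfolding \<Phi>.inj_on_one_iff using \<Phi>(2) by blast
  moreover have "\<Phi> ` carrier ?S = carrier G"
  proof
    show "carrier G \<subseteq> \<Phi> ` carrier ?S"
    proof
      fix y assume "y \<in> carrier G"
      then obtain x where "x \<in> carrier ?S" "y = \<one> \<otimes> \<Phi> x" using \<Phi>(3) exp unfolding set_mult_def by blast
      then show "y \<in> \<Phi> ` carrier ?S" by simp
    qed
  qed auto
  ultimately have "\<Phi> \<in> iso ?S G" using \<Phi>(1) by (simp add: iso_iff)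
  then have "?S \<cong> G" by (rule is_isoI)
  then show ?thesis using group.iso_sym[OF grp] by blast
qed

text \<open>\<open>C\<close> is cyclic of order 4, generated by \<open>g\<close>. An element
  \<open>y\<close> with nontrivial square has the same square as \<open>g\<close>, so
  \<open>y \<oslash> g\<close> has trivial square. Hence \<open>C\<close> and
  \<open>torsion 2\<close> generate the group, and the complement of \<open>C\<close> supplies the
  direct sum.\<close>

lemma iso_Z4_sum_group:
  assumes inf: "infinite (carrier G)" and g: "g \<in> carrier G" "g \<otimes> g \<noteq> \<one>"
    and sq: "\<And>x. x \<in> carrier G \<Longrightarrow> x \<otimes> x = \<one> \<or> x \<otimes> x = g \<otimes> g"
  shows "\<exists>I :: 'a set. G \<cong> integer_mod_group 4 \<times>\<times> sum_group I (\<lambda>_. integer_mod_group 2)"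
proof -
  define c where "c = g \<otimes> g"
  \<comment> \<open>\<open>c \<otimes> c\<close> is \<one> or \<open>c\<close> by \<open>sq\<close>,
    and the second would give \<open>c = \<one>\<close>.\<close>
  have c: "c \<in> carrier G" "c \<noteq> \<one>" "c \<otimes> c = \<one>"
    using g sq[of c] by (auto simp: c_def)
  have "g [^] (4 :: int) = g [^] (2 + 2 :: int)" by simp
  also have "\<dots> = c \<otimes> c" using g(1) by (simp only: int_pow_mult int_pow_two c_def)
  finally have gT: "g \<in> torsion (int 4)" using g c by (simp add: torsion_def)
  let ?Z = "integer_mod_group 4"
  define \<psi> where "\<psi> k = g [^] k" for k :: int
  have \<psi>: "\<psi> \<in> hom ?Z G"
    unfolding \<psi>_def by (rule int_pow_hom_integer_mod_group[OF gT])
  interpret \<psi>: group_hom ?Z G \<psi>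
    using \<psi> by (simp add: group_hom_def group_hom_axioms_def is_group)
  define C where "C = \<psi> ` carrier ?Z"
  have C: "subgroup C G" unfolding C_def by (rule \<psi>.img_is_subgroup)
  obtain I :: "'a set" and \<Phi> where \<Phi>: "\<Phi> \<in> hom (sum_group I (\<lambda>_. integer_mod_group 2)) G"
    "\<And>x. x \<in> carrier (sum_group I (\<lambda>_. integer_mod_group 2)) \<Longrightarrow> \<Phi> x \<in> C \<Longrightarrow>
      x = \<one>\<^bsub>sum_group I (\<lambda>_. integer_mod_group 2)\<^esub>"
    "torsion (int 2) \<subseteq> C <#> \<Phi> ` carrier (sum_group I (\<lambda>_. integer_mod_group 2))"
    using exists_sum_group_complement[OF inf C two_is_prime_nat] by metis
  let ?S = "sum_group I (\<lambda>_. integer_mod_group 2)"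
  have grpS: "group ?S" by simp
  interpret \<Phi>: group_hom ?S G \<Phi>
    using \<Phi>(1) grpS by (simp add: group_hom_def group_hom_axioms_def is_group)
  let ?D = "?Z \<times>\<times> ?S"
  have grpD: "group ?D" using grpS by (intro DirProd_group) simp_all
  define \<Theta> where "\<Theta> = (\<lambda>(k, x). \<psi> k \<otimes> \<Phi> x)"
  have \<Theta>: "\<Theta> \<in> hom ?D G"
  proof (rule homI)
    fix a assume "a \<in> carrier ?D"
    then show "\<Theta> a \<in> carrier G" by (auto simp: \<Theta>_def)
  next
    fix a b assume ab: "a \<in> carrier ?D" "b \<in> carrier ?D"
    obtain k x l y where kx: "a = (k, x)" "b = (l, y)" by fastforce
    then have carr: "k \<in> carrier ?Z" "l \<in> carrier ?Z" "x \<in> carrier ?S" "y \<in> carrier ?S" using ab by auto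
    have "\<Theta> (a \<otimes>\<^bsub>?D\<^esub> b) = \<psi> (k \<otimes>\<^bsub>?Z\<^esub> l) \<otimes> \<Phi> (x \<otimes>\<^bsub>?S\<^esub> y)"
      by (simp add: \<Theta>_def kx)
    also have "\<dots> = (\<psi> k \<otimes> \<psi> l) \<otimes> (\<Phi> x \<otimes> \<Phi> y)"
      using carr by (simp only: \<psi>.hom_mult \<Phi>.hom_mult)
    also have "\<dots> = \<Theta> a \<otimes> \<Theta> b"
      using carr by (simp add: \<Theta>_def kx m_ac)
    finally show "\<Theta> (a \<otimes>\<^bsub>?D\<^esub> b) = \<Theta> a \<otimes> \<Theta> b" .
  qed
  interpret \<Theta>: group_hom ?D G \<Theta>
    using \<Theta> grpD by (simp add: group_hom_def group_hom_axioms_def is_group)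
  have "inj_on \<Theta> (carrier ?D)"
    unfolding \<Theta>.inj_on_one_iff
  proof (intro allI impI)
    fix a assume a: "a \<in> carrier ?D" "\<Theta> a = \<one>"
    obtain k x where kx: "a = (k, x)" by fastforce
    then have carr: "k \<in> carrier ?Z" "x \<in> carrier ?S" using a by auto
    have eq: "\<psi> k \<otimes> \<Phi> x = \<one>" using a kx by (simp add: \<Theta>_def)
    then have "\<Phi> x = inv (\<psi> k)" using carr by (metis \<psi>.hom_closed \<Phi>.hom_closed inv_equality inv_inv m_comm)
    then have "\<Phi> x \<in> C" using carr subgroup.m_inv_closed[OF C] by (simp add: C_def)
    then have x: "x = \<one>\<^bsub>?S\<^esub>" using \<Phi>(2) carr by blast
    then have k1: "g [^] k = \<one>" using eq \<psi>.hom_closed[OF carr(1)] \<Phi>.hom_one by (simp add: \<psi>_def)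
    have "k = 0"
    proof (rule ccontr)
      assume "k \<noteq> 0"
      then have "k \<in> {1, 2, 3}" using carr(1) by (auto simp: carrier_integer_mod_group)
      moreover have "g [^] (2 :: int) \<noteq> \<one>" using g by (simp add: int_pow_two)
      moreover have "g [^] (1 :: int) \<noteq> \<one>" using g by auto
      moreover have "g [^] (3 :: int) \<noteq> \<one>"
      proof
        assume "g [^] (3 :: int) = \<one>"
        moreover have "coprime (int 4) 3" using coprime_add_one_left[of "3 :: int"] by simp
        ultimately have "g = \<one>" using torsion_coprime[OF g(1)] gT by (auto simp: torsion_def)
        then show False using g by simp
      qed
      ultimately show False using k1 by auto
    qed
    then show "a = \<one>\<^bsub>?D\<^esub>" using x kx by simp
  qed
  moreover have "\<Theta> ` carrier ?D = carrier G"
  proof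
    show "\<Theta> ` carrier ?D \<subseteq> carrier G" by auto
    show "carrier G \<subseteq> \<Theta> ` carrier ?D"
    proof
      fix y assume y: "y \<in> carrier G"
      have "\<exists>z\<in>C. y \<oslash> z \<in> torsion (int 2)"
      proof (cases "y \<otimes> y = \<one>")
        case True
        then show ?thesis using y subgroup.one_closed[OF C]
          by (intro bexI[of _ \<one>]) (simp_all add: torsion_def int_pow_two)
      next
        case False
        have "g = \<psi> 1" using g by (simp add: \<psi>_def)
        then have "g \<in> C" unfolding C_def by (simp add: carrier_integer_mod_group)
        moreover have "(y \<oslash> g) \<otimes> (y \<oslash> g) = \<one>"
          using y g(1) sq[OF y] False by (simp add: gdiv_simps)
        ultimately show ?thesis using y g by (intro bexI[of _ g]) (simp_all add: torsion_def int_pow_two)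
      qed
      then obtain z where z: "z \<in> C" "y \<oslash> z \<in> C <#> \<Phi> ` carrier ?S" using \<Phi>(3) by blast
      then obtain d x where dx: "d \<in> C" "x \<in> carrier ?S" "y \<oslash> z = d \<otimes> \<Phi> x"
        by (auto simp: set_mult_def)
      have carr: "z \<in> carrier G" "d \<in> carrier G" "\<Phi> x \<in> carrier G"
        using z(1) dx subgroup.mem_carrier[OF C] by auto
      have "y = d \<otimes> \<Phi> x \<otimes> z" using dx(3) y carr by (simp add: gdiv_simps)
      then have "y = (z \<otimes> d) \<otimes> \<Phi> x" using carr by (simp add: m_ac)
      moreover have "z \<otimes> d \<in> C" using z(1) dx(1) subgroup.m_closed[OF C] by blast
      moreover then obtain k where "k \<in> carrier ?Z" "z \<otimes> d = \<psi> k" unfolding C_def by blast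
      ultimately have "y = \<Theta> (k, x)" "(k, x) \<in> carrier ?D" using dx(2) by (simp_all add: \<Theta>_def)
      then show "y \<in> \<Theta> ` carrier ?D" by (rule image_eqI)
    qed
  qed
  ultimately have "\<Theta> \<in> iso ?D G" using \<Theta> by (simp add: iso_iff)
  then have "?D \<cong> G" by (rule is_isoI)
  then show ?thesis using group.iso_sym[OF grpD] by blast
qed

section \<open>Cubes and squares in the exceptional groups\<close>

lemma sum_group_3_exponent:
  assumes iso: "G \<cong> sum_group I (\<lambda>_. integer_mod_group 3)" and x: "x \<in> carrier G"
  shows "x \<otimes> x \<otimes> x = \<one>"
proof -
  let ?S = "sum_group I (\<lambda>_. integer_mod_group 3)"
  obtain h where h: "h \<in> hom G ?S" "inj_on h (carrier G)"
    using iso by (auto simp: is_iso_def iso_iff)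
  have grp: "group ?S" by simp
  interpret h: group_hom G ?S h
    using h grp by (simp add: group_hom_def group_hom_axioms_def is_group)
  have "h (x \<otimes> x \<otimes> x) = h x \<otimes>\<^bsub>?S\<^esub> h x \<otimes>\<^bsub>?S\<^esub> h x" using x by simp
  also have "\<dots> = \<one>\<^bsub>?S\<^esub>"
  proof -
    have "((a + a) mod 3 + a) mod 3 = 0" for a :: int by presburger
    then show ?thesis unfolding mult_sum_group one_sum_group by (intro restrict_ext) simp
  qed
  finally show ?thesis
    by (rule h.inj_on_one_iff[THEN iffD1, OF h(2), rule_format, rotated]) (use x in simp)
qed

lemma sum_group_2_exponent:
  assumes iso: "G \<cong> sum_group I (\<lambda>_. integer_mod_group 2)" and x: "x \<in> carrier G"
  shows "x \<otimes> x = \<one>"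
proof -
  let ?S = "sum_group I (\<lambda>_. integer_mod_group 2)"
  obtain h where h: "h \<in> hom G ?S" "inj_on h (carrier G)"
    using iso by (auto simp: is_iso_def iso_iff)
  have grp: "group ?S" by simp
  interpret h: group_hom G ?S h
    using h grp by (simp add: group_hom_def group_hom_axioms_def is_group)
  have "h (x \<otimes> x) = h x \<otimes>\<^bsub>?S\<^esub> h x" using x by simp
  also have "\<dots> = \<one>\<^bsub>?S\<^esub>"
  proof -
    have "(a + a) mod 2 = 0" for a :: int by presburger
    then show ?thesis unfolding mult_sum_group one_sum_group by (intro restrict_ext) simp
  qed
  finally show ?thesis
    by (rule h.inj_on_one_iff[THEN iffD1, OF h(2), rule_format, rotated]) (use x in simp)
qed

text \<open>Doubling in the direct product leaves 0 or 2 in the first component and the identity in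
  the second; \<open>c\<close> is the preimage of the value with 2.\<close>

lemma Z4_sum_group_squares:
  assumes iso: "G \<cong> integer_mod_group 4 \<times>\<times> sum_group I (\<lambda>_. integer_mod_group 2)"
  shows "\<exists>c. \<forall>x\<in>carrier G. x \<otimes> x = \<one> \<or> x \<otimes> x = c"
proof -
  let ?S = "sum_group I (\<lambda>_. integer_mod_group 2)"
  let ?D = "integer_mod_group 4 \<times>\<times> ?S"
  obtain h where h: "h \<in> hom G ?D" "inj_on h (carrier G)"
    using iso by (auto simp: is_iso_def iso_iff)
  have grp: "group ?D" by (intro DirProd_group) simp_all
  interpret h: group_hom G ?D h
    using h grp by (simp add: group_hom_def group_hom_axioms_def is_group)
  have "x \<otimes> x = \<one> \<or> x \<otimes> x = inv_into (carrier G) h (2, \<one>\<^bsub>?S\<^esub>)" if x: "x \<in> carrier G" for x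
  proof -
    obtain k f where kf: "h x = (k, f)" by fastforce
    have "h (x \<otimes> x) = h x \<otimes>\<^bsub>?D\<^esub> h x" using x by simp
    also have "\<dots> = ((k + k) mod 4, \<one>\<^bsub>?S\<^esub>)"
    proof -
      have "(a + a) mod 2 = 0" for a :: int by presburger
      then have "f \<otimes>\<^bsub>?S\<^esub> f = \<one>\<^bsub>?S\<^esub>"
        unfolding mult_sum_group one_sum_group by (intro restrict_ext) simp
      then show ?thesis by (simp only: kf mult_DirProd mult_integer_mod_group) simp
    qed
    finally have eq: "h (x \<otimes> x) = ((k + k) mod 4, \<one>\<^bsub>?S\<^esub>)" .
    have "(k + k) mod 4 = 0 \<or> (k + k) mod 4 = 2" by presburger
    then show ?thesis
    proof
      assume "(k + k) mod 4 = 0"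
      then have "h (x \<otimes> x) = \<one>\<^bsub>?D\<^esub>" using eq by simp
      then show ?thesis
        using h.inj_on_one_iff[THEN iffD1, OF h(2), rule_format, of "x \<otimes> x"] x by simp
    next
      assume "(k + k) mod 4 = 2"
      then have "h (x \<otimes> x) = (2, \<one>\<^bsub>?S\<^esub>)" using eq by simp
      then show ?thesis using inv_into_f_f[OF h(2), of "x \<otimes> x"] x by simp
    qed
  qed
  then show ?thesis by blast
qed

subsection \<open>Possible values of the sharp packing index\<close>

text \<open>The singleton of \<one> is a clique for every \<open>A\<close>, so the index exceeds
  1.\<close>

lemma natLeq_on_2_ordLeq_sharp_packing_index:
  assumes A: "A \<subseteq> carrier G" and \<kappa>: "Card_order \<kappa>" "sharp_packing_index G A =o \<kappa>"
  shows "natLeq_on 2 \<le>o \<kappa>"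
proof (rule ccontr)
  assume "\<not> ?thesis"
  then have "finite (Field \<kappa>)" "card (Field \<kappa>) \<le> card {\<one>}"
    by (auto simp: natLeq_on_ordLeq_iff[OF \<kappa>(1)])
  then have "|Field \<kappa>| \<le>o |{\<one>}|"
    by (simp add: card_of_ordLeq[symmetric] inj_on_iff_card_le del: card.insert card.empty)
  then have "\<kappa> \<le>o |{\<one>}|" using ordIso_ordLeq_iff(1)[OF card_of_Field_ordIso[OF \<kappa>(1)]] by blast
  moreover have "clique (carrier G - quotients A) {\<one>}" by (simp add: clique_def)
  then have "|{\<one>}| <o \<kappa>" using sharp_packing_index_ordIso_iff[OF A \<kappa>(1)] \<kappa>(2) by blast
  ultimately show False using not_ordLess_ordLeq by blast
qed

lemma sharp_packing_index_ordLeq_cardSuc: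
  assumes "sharp_packing_index G A =o \<kappa>"
  shows "\<kappa> \<le>o cardSuc |carrier G|"
  using sharp_packing_index_least[OF cardSuc_Card_order[OF card_of_Card_order] no_packing_of_size_cardSuc]
  by (rule ordIso_ordLeq_iff(1)[OF assms, THEN iffD1])

text \<open>All translates of the empty set are empty, so the whole group is a packing and the upper
  bound is attained.\<close>

lemma sharp_packing_index_empty: "sharp_packing_index G {} =o cardSuc |carrier G|"
proof -
  have "|C| <o cardSuc |carrier G|" if "clique (carrier G - quotients {}) C" for C
    using that card_of_mono1[of C "carrier G"]
      ordLeq_ordLess_trans[OF _ cardSuc_greater[OF card_of_Card_order]] by (simp add: clique_def)
  moreover have "\<mu> \<le>o |carrier G|" if "Card_order \<mu>" "\<mu> <o cardSuc |carrier G|" for \<mu> :: "'a set rel"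
    using cardSuc_ordLeq_ordLess[OF card_of_Card_order that(1)] that(2) by blast
  moreover have "clique (carrier G - quotients {}) (carrier G)"
    by (auto simp: clique_def quotients_def)
  ultimately show ?thesis
    using sharp_packing_index_ordIso_iff[of "{}", OF _ cardSuc_Card_order[OF card_of_Card_order[of "carrier G"]]]
    by blast
qed

lemma exists_sharp_packing_index_generic:
  assumes inf: "infinite (carrier G)" and \<kappa>: "Card_order \<kappa>"
    and bounds: "natLeq_on 2 \<le>o \<kappa>" "\<kappa> \<le>o cardSuc |carrier G|"
    and ne: "\<not> \<kappa> =o natLeq_on 3" "\<not> \<kappa> =o natLeq_on 4"
  shows "\<exists>A\<subseteq>carrier G. sharp_packing_index G A =o \<kappa>"
proof (cases "finite (Field \<kappa>)")
  case True
  define n where "n = card (Field \<kappa>)"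
  have eq: "\<kappa> =o natLeq_on n"
    using finite_Card_order_ordIso_natLeq_on[OF \<kappa> True] by (simp add: n_def)
  have "n \<ge> 2" using bounds(1) True by (simp add: natLeq_on_ordLeq_iff[OF \<kappa>] n_def)
  moreover have "n \<noteq> 3" "n \<noteq> 4" using eq ne by blast+
  ultimately consider "n = 2" | "n \<ge> 5" by linarith
  then have "\<exists>A\<subseteq>carrier G. sharp_packing_index G A =o natLeq_on n"
  proof cases
    case 1
    then show ?thesis using exists_sharp_packing_index_2[OF inf] by simp
  next
    case 2
    obtain r E where E: "r \<in> {0, 2, 3}" "E \<subseteq> torsion r" "|E| =o |carrier G|" "independent r E"
      using exists_independent[OF inf] by blast
    have "infinite E" using E(3) inf card_of_ordIso_finite by blast
    \<comment> \<open>Here \<open>n - 1 \<ge> 4\<close> points are used, which suffices for every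
      \<open>r\<close>.\<close>
    then have "\<exists>A\<subseteq>carrier G. sharp_packing_index G A =o natLeq_on (Suc (n - 1))"
      using 2 E by (intro exists_sharp_packing_index_independent[OF inf, of E r]) auto
    then show ?thesis using 2 by simp
  qed
  then show ?thesis using ordIso_transitive[OF _ ordIso_symmetric[OF eq]] by blast
next
  case False
  show ?thesis
  proof (cases "\<kappa> =o cardSuc |carrier G|")
    case True
    then have "sharp_packing_index G {} =o \<kappa>"
      using ordIso_transitive[OF sharp_packing_index_empty ordIso_symmetric] by blast
    then show ?thesis by blast
  next
    case neq: False
    then have "\<kappa> <o cardSuc |carrier G|" using bounds(2) ordLeq_iff_ordLess_or_ordIso by blast
    then have "\<kappa> \<le>o |carrier G|" using cardSuc_ordLeq_ordLess[OF card_of_Card_order \<kappa>] by blast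
    then have "|Field \<kappa>| \<le>o |carrier G|"
      using ordIso_ordLeq_iff(1)[OF card_of_Field_ordIso[OF \<kappa>]] by blast
    then obtain A where "A \<subseteq> carrier G" "sharp_packing_index G A =o |Field \<kappa>|"
      using exists_sharp_packing_index_infinite[OF inf False] by blast
    then show ?thesis using ordIso_transitive[OF _ card_of_Field_ordIso[OF \<kappa>]] by blast
  qed
qed

text \<open>In exponent 3 the largest clique size cannot be 2; in any other exponent some
  \<open>g\<close> has a nontrivial cube.\<close>

lemma sharp_packing_index_3_iff:
  assumes inf: "infinite (carrier G)"
  shows "(\<exists>A\<subseteq>carrier G. sharp_packing_index G A =o natLeq_on 3) \<longleftrightarrow>
    \<not> (\<exists>I :: 'a set. G \<cong> sum_group I (\<lambda>_. integer_mod_group 3))" (is "?l \<longleftrightarrow> \<not> ?r")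
proof -
  have False if l: ?l and r: ?r
  proof -
    obtain A where A: "A \<subseteq> carrier G" "sharp_packing_index G A =o natLeq_on (Suc 2)"
      using l by (auto simp: numeral_3_eq_3 numeral_2_eq_2)
    let ?F = "carrier G - quotients A"
    have le: "card D \<le> 2" if "clique ?F D" for D
      using sharp_packing_index_natLeq_on_iff[OF A(1) inf] A(2) that by blast
    obtain C where "clique ?F C" "card C = 2"
      using sharp_packing_index_natLeq_on_iff[OF A(1) inf] A(2) by blast
    then obtain D where "clique ?F D" "card D = 3"
      using exponent_3_clique sum_group_3_exponent r by metis
    then show False using le[of D] by simp
  qed
  moreover have ?l if "\<not> ?r"
  proof -
    have "\<not> carrier G \<subseteq> torsion (int 3)" using iso_sum_group_prime[OF inf, of 3] that by auto
    then obtain g where g: "g \<in> carrier G" "g [^] (3 :: int) \<noteq> \<one>" by (auto simp: torsion_def)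
    have "g [^] (3 :: int) = g [^] (2 + 1 :: int)" by simp
    also have "\<dots> = g \<otimes> g \<otimes> g" using g(1) by (simp only: int_pow_mult int_pow_two int_pow_1)
    finally show ?thesis using exists_sharp_packing_index_3[OF inf g(1)] g(2) by simp
  qed
  ultimately show ?thesis by blast
qed

lemma sharp_packing_index_4_iff:
  assumes inf: "infinite (carrier G)"
  shows "(\<exists>A\<subseteq>carrier G. sharp_packing_index G A =o natLeq_on 4) \<longleftrightarrow>
    \<not> (\<exists>I :: 'a set. G \<cong> sum_group I (\<lambda>_. integer_mod_group 2)) \<and>
    \<not> (\<exists>I :: 'a set. G \<cong> integer_mod_group 4 \<times>\<times> sum_group I (\<lambda>_. integer_mod_group 2))"
    (is "?l \<longleftrightarrow> \<not> ?r1 \<and> \<not> ?r2")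
proof -
  \<comment> \<open>The two exceptional types together are the groups in which squaring takes at
    most one value besides \<one>.\<close>
  let ?sq = "\<exists>c. \<forall>x\<in>carrier G. x \<otimes> x = \<one> \<or> x \<otimes> x = c"
  have sq: "?sq \<longleftrightarrow> ?r1 \<or> ?r2"
  proof
    assume ?sq
    then obtain c where c: "\<And>x. x \<in> carrier G \<Longrightarrow> x \<otimes> x = \<one> \<or> x \<otimes> x = c" by blast
    show "?r1 \<or> ?r2"
    proof (cases "\<forall>x\<in>carrier G. x \<otimes> x = \<one>")
      case True
      then have "carrier G \<subseteq> torsion (int 2)" by (auto simp: torsion_def int_pow_two)
      then show ?thesis using iso_sum_group_prime[OF inf two_is_prime_nat] by blast
    next
      case False
      then obtain g where g: "g \<in> carrier G" "g \<otimes> g \<noteq> \<one>" by blast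
      then have "c = g \<otimes> g" using c[of g] by simp
      then show ?thesis using iso_Z4_sum_group[OF inf g] c by blast
    qed
  next
    assume "?r1 \<or> ?r2"
    then show ?sq using sum_group_2_exponent Z4_sum_group_squares by blast
  qed
  have False if l: ?l and r: ?sq
  proof -
    obtain A where A: "A \<subseteq> carrier G" "sharp_packing_index G A =o natLeq_on (Suc 3)"
      using l by (auto simp: numeral_eq_Suc)
    let ?F = "carrier G - quotients A"
    have le: "card D \<le> 3" if "clique ?F D" for D
      using sharp_packing_index_natLeq_on_iff[OF A(1) inf] A(2) that by blast
    obtain C where "clique ?F C" "card C = 3"
      using sharp_packing_index_natLeq_on_iff[OF A(1) inf] A(2) by blast
    then obtain D where "clique ?F D" "card D = 4"
      using equal_squares_clique r by metis
    then show False using le[of D] by simp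
  qed
  moreover have ?l if nsq: "\<not> ?sq"
  proof -
    obtain r E where E: "r \<in> {0, 2, 3}" "E \<subseteq> torsion r" "|E| =o |carrier G|" "independent r E"
      using exists_independent[OF inf] by blast
    have infE: "infinite E" using E(3) inf card_of_ordIso_finite by blast
    show ?thesis
    \<comment> \<open>Three independent elements give clique number 3 unless \<open>r = 2\<close>,
      where the triangle would make it 4; then \<open>torsion 2\<close> is infinite and the hexagon
      applies.\<close>
    proof (cases "r = 2")
      case True
      then have "infinite (torsion 2)" using infE E(2) finite_subset by blast
      then show ?thesis using nsq by (intro exists_sharp_packing_index_4_squares[OF inf]) blast+
    next
      case False
      then have "\<exists>A\<subseteq>carrier G. sharp_packing_index G A =o natLeq_on (Suc 3)"
        using E infE by (intro exists_sharp_packing_index_independent[OF inf, of E r]) auto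
      then show ?thesis by (simp add: numeral_eq_Suc)
    qed
  qed
  ultimately show ?thesis using sq by blast
qed

end

theorem mainTheorem1:
  fixes G :: "('a, 'm) monoid_scheme" and \<kappa> :: "'k rel"
  assumes "comm_group G" and "infinite (carrier G)" and "Card_order \<kappa>"
  shows "(\<exists>A \<subseteq> carrier G. sharp_packing_index G A =o \<kappa>) \<longleftrightarrow>
    (natLeq_on 2 \<le>o \<kappa> \<and> \<kappa> \<le>o cardSuc |carrier G| \<and>
       \<not> \<kappa> =o natLeq_on 3 \<and> \<not> \<kappa> =o natLeq_on 4) \<or>
    (\<kappa> =o natLeq_on 3 \<and>
       \<not> (\<exists>I :: 'a set. G \<cong> sum_group I (\<lambda>_. integer_mod_group 3))) \<or>
    (\<kappa> =o natLeq_on 4 \<and>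
       \<not> (\<exists>I :: 'a set. G \<cong> sum_group I (\<lambda>_. integer_mod_group 2)) \<and>
       \<not> (\<exists>I :: 'a set. G \<cong> integer_mod_group 4 \<times>\<times> sum_group I (\<lambda>_. integer_mod_group 2)))"
proof -
  interpret comm_group G by fact
  \<comment> \<open>Transfers the results on the concrete cardinals 3 and 4 to a
    \<open>\<kappa>\<close> over another type.\<close>
  have cong: "(\<exists>A\<subseteq>carrier G. sharp_packing_index G A =o \<kappa>) \<longleftrightarrow>
      (\<exists>A\<subseteq>carrier G. sharp_packing_index G A =o natLeq_on n)" if eq: "\<kappa> =o natLeq_on n" for n
    using ordIso_transitive[OF _ eq] ordIso_transitive[OF _ ordIso_symmetric[OF eq]] by blast
  have bounds: "natLeq_on 2 \<le>o \<kappa> \<and> \<kappa> \<le>o cardSuc |carrier G|"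
    if "A \<subseteq> carrier G" "sharp_packing_index G A =o \<kappa>" for A
    using natLeq_on_2_ordLeq_sharp_packing_index[OF that(1) assms(3) that(2)]
      sharp_packing_index_ordLeq_cardSuc[OF that(2)] by blast
  have distinct: "\<not> (\<kappa> =o natLeq_on 3 \<and> \<kappa> =o natLeq_on 4)"
  proof
    assume "\<kappa> =o natLeq_on 3 \<and> \<kappa> =o natLeq_on 4"
    then have "natLeq_on 4 \<le>o natLeq_on 3"
      using ordIso_imp_ordLeq[OF ordIso_transitive[OF ordIso_symmetric]] by blast
    then show False
      by (simp add: natLeq_on_ordLeq_iff[OF Card_order_natLeq_on] Field_natLeq_on)
  qed
  show ?thesis
  proof (cases "\<kappa> =o natLeq_on 3")
    case True
    then have "\<not> \<kappa> =o natLeq_on 4" using distinct by blast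
    with True show ?thesis
      using cong[OF True] sharp_packing_index_3_iff[OF assms(2)] by simp
  next
    case neq3: False
    show ?thesis
    proof (cases "\<kappa> =o natLeq_on 4")
      case True
      with neq3 show ?thesis
        using cong[OF True] sharp_packing_index_4_iff[OF assms(2)] by simp
    next
      case False
      then show ?thesis
        using neq3 bounds exists_sharp_packing_index_generic[OF assms(2,3)] by blast
    qed
  qed
qed

end
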